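(* Let $n\ge1$, $T>0$, let $\Omega'\subset\mathbb{R}^{n+1}$ be bounded, open and connected, $\Omega=\Omega'\cap([0,T]\times\mathbb{R}^n)$, with time sections $\Omega_t=\{x:(t,x)\in\Omega\}$ nonempty, bounded and connected for $t\in[0,T]$. Let $\gamma\in\mathcal{C}^{1,2}([0,T]\times\mathbb{R}^n,S(0,1))$ and $\rho\in(0,1)$ with $\bigcup_{0\le\zeta\le\rho}B(x-\zeta\gamma(t,x),\zeta\rho)\subset\Omega_t^c$ for all $x\in\partial\Omega_t$, $t\in[0,T]$, and assume $d(\cdot,x)\in\mathcal{H}^1([0,T],[0,\infty))$ for all $x$, where $d(t,x)=\operatorname{dist}(x,\Omega_t)$. Let $\psi\in\mathcal{C}([0,T],\mathbb{R}^n)$ with $\psi(0)\in\overline\Omega_0$. Then there exists a solution $(\phi,\lambda)$ to the Skorohod problem for $(\Omega,\gamma,\psi)$.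
   Context: For $\eta$ of bounded variation, $|\eta|(t)$ is its total variation on $[0,t]$. A pair $(\phi,\lambda)\in\mathcal{C}([0,T],\mathbb{R}^n)^2$ solves the Skorohod problem for $(\Omega,\gamma,\psi)$ if for all $t\in[0,T]$: $\phi(t)=\psi(t)+\lambda(t)$, $\phi(0)=\psi(0)$; $\phi(t)\in\overline\Omega_t$; $|\lambda|(T)<\infty$; $|\lambda|(t)=\int_{(0,t]}I_{\{\phi(s)\in\partial\Omega_s\}}d|\lambda|(s)$; and $\lambda(t)=\int_{(0,t]}\hat\gamma(s)d|\lambda|(s)$ for some measurable $\hat\gamma:[0,T]\to\mathbb{R}^n$ with $\hat\gamma(s)=\gamma(s,\phi(s))$ $d|\lambda|$-a.e. *)

theory Defs
  imports "HOL-Analysis.Analysis"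
begin

definition tsection :: "('t \<times> 'a) set \<Rightarrow> 't \<Rightarrow> 'a set" where
  "tsection Om t = {x. (t, x) \<in> Om}"

definition total_variation :: "(real \<Rightarrow> 'a::real_normed_vector) \<Rightarrow> real \<Rightarrow> real \<Rightarrow> ereal" where
  "total_variation f a b =
     (SUP pn \<in> {(p, n). p 0 = a \<and> p n = b \<and> (\<forall>i<n. p i \<le> p (Suc i))}.
        ereal (\<Sum>i<snd pn. norm (f (fst pn (Suc i)) - f (fst pn i))))"

text \<open>The function t |-> |lam|(t), the total variation on [0,t], extended constantly
  outside [0,T] (so that it is a nondecreasing continuous distribution function on the reals).\<close>
definition tv_fun :: "real \<Rightarrow> (real \<Rightarrow> 'a::real_normed_vector) \<Rightarrow> real \<Rightarrow> real" where
  "tv_fun T lam t = real_of_ereal (total_variation lam 0 (max 0 (min t T)))"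

definition tv_measure :: "real \<Rightarrow> (real \<Rightarrow> 'a::real_normed_vector) \<Rightarrow> real measure" where
  "tv_measure T lam = interval_measure (tv_fun T lam)"

definition skorohod_solution ::
  "real \<Rightarrow> (real \<times> 'a::euclidean_space) set \<Rightarrow> (real \<times> 'a \<Rightarrow> 'a) \<Rightarrow> (real \<Rightarrow> 'a)
     \<Rightarrow> (real \<Rightarrow> 'a) \<Rightarrow> (real \<Rightarrow> 'a) \<Rightarrow> bool" where
  "skorohod_solution T Om gamma psi phi lam \<longleftrightarrow>
     continuous_on {0..T} phi \<and> continuous_on {0..T} lam \<and>
     (\<forall>t\<in>{0..T}. phi t = psi t + lam t) \<and> phi 0 = psi 0 \<and>
     (\<forall>t\<in>{0..T}. phi t \<in> closure (tsection Om t)) \<and>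
     total_variation lam 0 T < \<infinity> \<and>
     (\<forall>t\<in>{0..T}. tv_fun T lam t =
        (LINT s:{0<..t}|tv_measure T lam. indicator {s. phi s \<in> frontier (tsection Om s)} s)) \<and>
     (\<exists>ghat. ghat \<in> borel_measurable borel \<and>
        (AE s in tv_measure T lam. ghat s = gamma (s, phi s)) \<and>
        (\<forall>t\<in>{0..T}. set_integrable (tv_measure T lam) {0<..t} ghat \<and>
                     lam t = (LINT s:{0<..t}|tv_measure T lam. ghat s)))"

definition C12_on :: "real \<Rightarrow> (real \<times> 'a::euclidean_space \<Rightarrow> 'b::euclidean_space) \<Rightarrow> bool" where
  "C12_on T g \<longleftrightarrow>
     (\<exists>(gt :: real \<times> 'a \<Rightarrow> 'b) (gx :: real \<times> 'a \<Rightarrow> 'a \<Rightarrow>\<^sub>L 'b)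
        (gxx :: real \<times> 'a \<Rightarrow> 'a \<Rightarrow>\<^sub>L ('a \<Rightarrow>\<^sub>L 'b)).
       continuous_on ({0..T} \<times> UNIV) g \<and> continuous_on ({0..T} \<times> UNIV) gt \<and>
       continuous_on ({0..T} \<times> UNIV) gx \<and> continuous_on ({0..T} \<times> UNIV) gxx \<and>
       (\<forall>t\<in>{0..T}. \<forall>x.
          ((\<lambda>s. g (s, x)) has_vector_derivative gt (t, x)) (at t within {0..T}) \<and>
          ((\<lambda>y. g (t, y)) has_derivative blinfun_apply (gx (t, x))) (at x) \<and>
          ((\<lambda>y. gx (t, y)) has_derivative blinfun_apply (gxx (t, x))) (at x)))"

text \<open>f is in the Sobolev space H^1([0,T],[0,oo)) = W^{1,2}: nonnegative on [0,T] and
  absolutely continuous with weak derivative in L^2(0,T).\<close>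
definition H1_on :: "real \<Rightarrow> (real \<Rightarrow> real) \<Rightarrow> bool" where
  "H1_on T f \<longleftrightarrow>
     (\<forall>t\<in>{0..T}. f t \<ge> 0) \<and>
     (\<exists>g. g absolutely_integrable_on {0..T} \<and> (\<lambda>s. (g s)\<^sup>2) integrable_on {0..T} \<and>
          (\<forall>t\<in>{0..T}. (g has_integral (f t - f 0)) {0..t}))"

end

theory Submission
  imports Defs "HOL-Complex_Analysis.Great_Picard"
begin

text \<open>The reflection problem is discretised in time: at each step the position moves with \<open>psi\<close> and,
  if it has left the domain, is pushed back along \<open>gamma\<close> until it first meets the boundary. Let \<open>L\<close>
  be the accumulated length of the pushes. At a push, the exterior cone at the boundary point reached
  contains a ball of radius \<open>rho * l\<close> about the point lying \<open>l\<close> behind it. When \<open>l\<close> is the recent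
  increment of \<open>L\<close>, this point nearly is an earlier position, which lay in the closed domain; so \<open>l\<close>
  is bounded by the oscillations of \<open>psi\<close> and of the domain. Hence the approximations are
  asymptotically equicontinuous. A limit \<open>(lam, L)\<close> satisfies
  \<open>norm (lam t - lam s - (L t - L s) * gamma (s, phi s)) \<le> e * (L t - L s)\<close> for \<open>t - s\<close> small, which
  identifies \<open>L\<close> as the total variation of \<open>lam\<close>, and \<open>lam\<close> as the integral of \<open>gamma\<close> against \<open>dL\<close>.\<close>

subsection \<open>Total variation and compactness\<close>

lemma uniform_partition:
  fixes a b d :: real
  assumes "a \<le> b" "0 < d"
  obtains p :: "nat \<Rightarrow> real" and n
  where "p 0 = a" "p n = b" "\<And>i. p i \<le> p (Suc i)" "\<And>i. p (Suc i) - p i \<le> d"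
    "\<And>i. i \<le> n \<Longrightarrow> a \<le> p i \<and> p i \<le> b"
proof -
  \<comment> \<open>The strict inequality forces \<open>n > 0\<close> even when
    \<open>a = b\<close>, so dividing by \<open>n\<close> is legitimate.\<close>
  obtain n :: nat where n: "(b - a) / d < real n"
    using reals_Archimedean2 by blast
  have n0: "0 < real n"
    by (rule le_less_trans[OF _ n]) (use assms in simp)
  define p where "p i = a + real i * ((b - a) / real n)" for i :: nat
  have step: "p (Suc i) - p i = (b - a) / real n" for i
    by (simp add: p_def algebra_simps add_divide_distrib diff_divide_distrib)
  show thesis
  proof
    show "p 0 = a" "p n = b"
      using n0 by (simp_all add: p_def)
    show "p i \<le> p (Suc i)" for i
      using step[of i] n0 assms by (smt (verit) divide_nonneg_pos)
    show "p (Suc i) - p i \<le> d" for i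
      using n n0 assms by (simp add: step field_simps)
    show "a \<le> p i \<and> p i \<le> b" if "i \<le> n" for i
    proof -
      have "real i * (b - a) \<le> real n * (b - a)"
        using that assms by (intro mult_right_mono) auto
      then have "real i * ((b - a) / real n) \<le> b - a"
        using n0 by (simp add: field_simps)
      then show ?thesis
        using assms n0 by (simp add: p_def)
    qed
  qed
qed

text \<open>Chaining: along a partition of mesh at most \<open>d\<close> the left sides obey the
  triangle inequality while the right sides telescope. This turns estimates valid only on short
  intervals into global ones.\<close>

lemma norm_increment_le_if_locally:
  fixes f :: "real \<Rightarrow> 'b::real_normed_vector" and G :: "real \<Rightarrow> real"
  assumes "a \<le> b" "0 < d"
    and loc: "\<And>s t. a \<le> s \<Longrightarrow> s \<le> t \<Longrightarrow> t \<le> b \<Longrightarrow> t - s \<le> d \<Longrightarrow> norm (f t - f s) \<le> G t - G s"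
  shows "norm (f b - f a) \<le> G b - G a"
proof -
  obtain p n where p: "p 0 = a" "p n = b" "\<And>i. p i \<le> p (Suc i)" "\<And>i. p (Suc i) - p i \<le> d"
    "\<And>i. i \<le> n \<Longrightarrow> a \<le> p i \<and> p i \<le> b"
    using uniform_partition[OF assms(1,2)] by metis
  have "f b - f a = (\<Sum>i<n. f (p (Suc i)) - f (p i))"
    using p by (simp add: sum_lessThan_telescope[of "\<lambda>i. f (p i)"])
  also have "norm \<dots> \<le> (\<Sum>i<n. norm (f (p (Suc i)) - f (p i)))"
    by (rule norm_sum)
  also have "\<dots> \<le> (\<Sum>i<n. G (p (Suc i)) - G (p i))"
    using p by (intro sum_mono loc) (auto simp: Suc_le_eq less_imp_le)
  also have "\<dots> = G b - G a"
    using p by (simp add: sum_lessThan_telescope[of "\<lambda>i. G (p i)"])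
  finally show ?thesis .
qed

text \<open>\<open>G\<close> acts as an arc length of \<open>f\<close>. By \<open>upper\<close>
  every partition sum is dominated by a telescoping sum of \<open>G\<close>. By \<open>lower\<close>
  a fine enough partition recovers all but the fraction \<open>e\<close> of
  \<open>G b - G a\<close>, and \<open>e\<close> tends to 0.\<close>

lemma total_variation_eqI:
  fixes f :: "real \<Rightarrow> 'b::real_normed_vector" and G :: "real \<Rightarrow> real"
  assumes "a \<le> b"
    and upper: "\<And>s t. a \<le> s \<Longrightarrow> s \<le> t \<Longrightarrow> t \<le> b \<Longrightarrow> norm (f t - f s) \<le> G t - G s"
    and lower: "\<And>e. 0 < e \<Longrightarrow> \<exists>d>0. \<forall>s t. a \<le> s \<longrightarrow> s \<le> t \<longrightarrow> t \<le> b \<longrightarrow> t - s \<le> d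
                  \<longrightarrow> (1 - e) * (G t - G s) \<le> norm (f t - f s)"
  shows "total_variation f a b = ereal (G b - G a)"
proof (rule antisym)
  show "total_variation f a b \<le> ereal (G b - G a)"
    unfolding total_variation_def
  proof (rule SUP_least, clarsimp)
    fix p :: "nat \<Rightarrow> real" and n
    assume p: "\<forall>i<n. p i \<le> p (Suc i)" "a = p 0" "b = p n"
    \<comment> \<open>A partition is monotone only up to index \<open>n\<close>; freezing it from
      there on gives a sequence monotone on all naturals.\<close>
    have mono: "p (min i n) \<le> p (min j n)" if "i \<le> j" for i j
      by (rule lift_Suc_mono_le[of "\<lambda>i. p (min i n)"]) (use p that in \<open>auto simp: min_def Suc_le_eq not_less\<close>)
    have range: "p 0 \<le> p i" "p i \<le> p n" if "i \<le> n" for i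
      using mono[of 0 i] mono[of i n] that by (auto simp: min_def)
    have "(\<Sum>i<n. norm (f (p (Suc i)) - f (p i))) \<le> (\<Sum>i<n. G (p (Suc i)) - G (p i))"
      using p range by (intro sum_mono upper) auto
    then show "(\<Sum>i<n. norm (f (p (Suc i)) - f (p i))) \<le> G (p n) - G (p 0)"
      by (simp add: sum_lessThan_telescope[of "\<lambda>i. G (p i)"])
  qed
next
  have "0 \<le> G b - G a"
    using upper[of a b] assms(1) norm_ge_zero order_trans by blast
  have *: "ereal ((1 - e) * (G b - G a)) \<le> total_variation f a b" if e: "0 < e" for e
  proof -
    obtain d where d: "d > 0" "\<And>s t. a \<le> s \<Longrightarrow> s \<le> t \<Longrightarrow> t \<le> b \<Longrightarrow> t - s \<le> d
                  \<Longrightarrow> (1 - e) * (G t - G s) \<le> norm (f t - f s)"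
      using lower[OF e] by blast
    obtain p n where p: "p 0 = a" "p n = b" "\<And>i. p i \<le> p (Suc i)" "\<And>i. p (Suc i) - p i \<le> d"
      "\<And>i. i \<le> n \<Longrightarrow> a \<le> p i \<and> p i \<le> b"
      using uniform_partition[OF assms(1) d(1)] by metis
    have "(1 - e) * (G b - G a) = (\<Sum>i<n. (1 - e) * (G (p (Suc i)) - G (p i)))"
      using p by (simp flip: sum_distrib_left add: sum_lessThan_telescope[of "\<lambda>i. G (p i)"])
    also have "\<dots> \<le> (\<Sum>i<n. norm (f (p (Suc i)) - f (p i)))"
      using p by (intro sum_mono d) (auto simp: Suc_le_eq less_imp_le)
    finally have "ereal ((1 - e) * (G b - G a)) \<le> ereal (\<Sum>i<n. norm (f (p (Suc i)) - f (p i)))"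
      by simp
    also have "\<dots> \<le> total_variation f a b"
      unfolding total_variation_def
      by (rule SUP_upper2[of "(p, n)"]) (use p in auto)
    finally show ?thesis .
  qed
  show "ereal (G b - G a) \<le> total_variation f a b"
  proof (rule tendsto_upperbound[where F = "at_right 0"])
    show "((\<lambda>e. ereal ((1 - e) * (G b - G a))) \<longlongrightarrow> ereal (G b - G a)) (at_right 0)"
      by (auto intro!: tendsto_eq_intros)
    show "\<forall>\<^sub>F e in at_right 0. ereal ((1 - e) * (G b - G a)) \<le> total_variation f a b"
      using * by (auto simp: eventually_at_filter intro!: always_eventually)
  qed simp
qed

text \<open>The functions may jump, as step functions do; only for large \<open>n\<close> are their
  oscillations at scale \<open>d\<close> below \<open>e\<close>. This still gives convergence at the
  rationals by a diagonal argument, then everywhere, to a continuous limit. The conclusion is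
  continuous convergence: the arguments \<open>u n\<close> may move with \<open>n\<close>, and a
  further subsequence \<open>k\<close> may be taken. Contact times, which vary with
  \<open>n\<close>, require this form.\<close>

lemma asymptotic_Arzela_Ascoli:
  fixes F :: "nat \<Rightarrow> real \<Rightarrow> 'b::euclidean_space"
  assumes zero: "\<And>n. F n 0 = 0"
    and equi: "\<And>e. 0 < e \<Longrightarrow> \<exists>d>0. \<exists>N. \<forall>n\<ge>N. \<forall>s t. 0 \<le> s \<longrightarrow> s \<le> t \<longrightarrow> t \<le> T \<longrightarrow> t - s \<le> d
                 \<longrightarrow> norm (F n t - F n s) \<le> e"
  obtains r :: "nat \<Rightarrow> nat" and f where "strict_mono r" "continuous_on {0..T} f"
    "\<forall>(k :: nat \<Rightarrow> nat) u w. strict_mono k \<longrightarrow> (\<forall>n. u n \<in> {0..T}) \<longrightarrow> w \<in> {0..T} \<longrightarrow> u \<longlonglongrightarrow> w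
       \<longrightarrow> (\<lambda>n. F (r (k n)) (u n)) \<longlonglongrightarrow> f w"
proof -
  obtain d N where d: "d > 0" and N: "\<And>n s t. n \<ge> N \<Longrightarrow> 0 \<le> s \<Longrightarrow> s \<le> t \<Longrightarrow> t \<le> T \<Longrightarrow> t - s \<le> d
                 \<Longrightarrow> norm (F n t - F n s) \<le> 1"
    using equi[OF zero_less_one] by blast
  \<comment> \<open>Walking from 0, where \<open>F n\<close> vanishes, to \<open>t\<close> in
    \<open>k\<close> steps of length at most \<open>d\<close> costs at most 1 per step.\<close>
  have bd: "norm (F n t) \<le> real k" if "n \<ge> N" "0 \<le> t" "t \<le> T" "t \<le> real k * d" for n t k
    using that
  proof (induction k arbitrary: t)
    case 0
    then show ?case using zero by simp
  next
    case (Suc k)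
    define s where "s = max 0 (t - d)"
    have "norm (F n s) \<le> real k"
      using Suc.prems d by (intro Suc.IH) (auto simp: s_def algebra_simps)
    moreover have "norm (F n t - F n s) \<le> 1"
      using Suc.prems d by (intro N) (auto simp: s_def)
    ultimately show ?case
      using norm_triangle_sub[of "F n t" "F n s"] by simp
  qed
  obtain K :: nat where "T / d < real K"
    using reals_Archimedean2 by blast
  then have K: "T \<le> real K * d"
    using d by (simp add: field_simps)
  define S where "S = {0..T} \<inter> \<rat>"
  have "countable S"
    unfolding S_def using countable_rat by (rule countable_subset[rotated]) auto
  moreover have "norm (F (n + N) x) \<le> real K" if "x \<in> S" for n x
    by (rule bd) (use that K in \<open>auto simp: S_def\<close>)
  \<comment> \<open>The index is shifted by \<open>N\<close> because the uniform bound holds only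
    from \<open>N\<close> on.\<close>
  ultimately obtain k where k: "strict_mono k"
    and lim: "\<And>x. x \<in> S \<Longrightarrow> \<exists>l. (\<lambda>n. F (k n + N) x) \<longlonglongrightarrow> l"
    using function_convergent_subsequence[of S "\<lambda>n. F (n + N)" "real K"] by metis
  define r where "r n = k n + N" for n
  have r: "strict_mono r"
    using k by (simp add: r_def strict_mono_def)
  have "\<exists>l. (\<lambda>n. F (r n) t) \<longlonglongrightarrow> l" if t: "t \<in> {0..T}" for t
  proof (cases "t = 0")
    case True
    then show ?thesis using zero by auto
  next
    case False
    then have t0: "0 < t" using t by auto
    have "Cauchy (\<lambda>n. F (r n) t)"
    proof (rule metric_CauchyI)
      fix e :: real assume e: "e > 0"
      obtain d M where d: "d > 0" and M: "\<And>n s t. n \<ge> M \<Longrightarrow> 0 \<le> s \<Longrightarrow> s \<le> t \<Longrightarrow> t \<le> T \<Longrightarrow> t - s \<le> d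
                 \<Longrightarrow> norm (F n t - F n s) \<le> e/4"
        using equi[of "e/4", OF divide_pos_pos[OF e zero_less_numeral]] by blast
      \<comment> \<open>A rational to the left of \<open>t\<close> stays in \<open>{0..T}\<close>
        even if \<open>t = T\<close>; its existence uses \<open>0 < t\<close>, hence the separate
        case \<open>t = 0\<close>.\<close>
      obtain q where q: "q \<in> \<rat>" "max 0 (t - d) < q" "q < t"
        using Rats_dense_in_real[of "max 0 (t - d)" t] t0 d by auto
      then have "q \<in> S" using t by (auto simp: S_def)
      then have "Cauchy (\<lambda>n. F (r n) q)"
        using lim LIMSEQ_imp_Cauchy by (fastforce simp: r_def)
      then obtain M' where M': "\<And>m n. m \<ge> M' \<Longrightarrow> n \<ge> M' \<Longrightarrow> dist (F (r m) q) (F (r n) q) < e/2"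
        using e metric_CauchyD[of "\<lambda>n. F (r n) q" "e/2"] by (metis half_gt_zero)
      have near: "dist (F (r n) t) (F (r n) q) \<le> e/4" if "n \<ge> M" for n
        unfolding dist_norm
        by (rule M) (use that q t seq_suble[OF r, of n] in auto)
      show "\<exists>M. \<forall>m\<ge>M. \<forall>n\<ge>M. dist (F (r m) t) (F (r n) t) < e"
      proof (intro exI allI impI)
        fix m n assume "m \<ge> max M M'" "n \<ge> max M M'"
        then have "dist (F (r m) t) (F (r m) q) \<le> e/4" "dist (F (r n) t) (F (r n) q) \<le> e/4"
          "dist (F (r m) q) (F (r n) q) < e/2"
          using near M' by auto
        then show "dist (F (r m) t) (F (r n) t) < e"
          by metric
      qed
    qed
    then show ?thesis
      using Cauchy_convergent convergent_def by blast
  qed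
  then obtain f where f: "\<And>t. t \<in> {0..T} \<Longrightarrow> (\<lambda>n. F (r n) t) \<longlonglongrightarrow> f t"
    by metis
  have "continuous_on {0..T} f"
    unfolding continuous_on_iff
  proof (intro ballI allI impI)
    fix x and e :: real assume x: "x \<in> {0..T}" and e: "e > 0"
    obtain d M where d: "d > 0" and M: "\<And>n s t. n \<ge> M \<Longrightarrow> 0 \<le> s \<Longrightarrow> s \<le> t \<Longrightarrow> t \<le> T \<Longrightarrow> t - s \<le> d
               \<Longrightarrow> norm (F n t - F n s) \<le> e/2"
      using equi[of "e/2", OF divide_pos_pos[OF e zero_less_numeral]] by blast
    have le: "norm (f t - f s) \<le> e/2" if "0 \<le> s" "s \<le> t" "t \<le> T" "t - s \<le> d" for s t
    proof (rule tendsto_upperbound)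
      show "(\<lambda>n. norm (F (r n) t - F (r n) s)) \<longlonglongrightarrow> norm (f t - f s)"
        using that by (intro tendsto_intros f) auto
      show "\<forall>\<^sub>F n in sequentially. norm (F (r n) t - F (r n) s) \<le> e/2"
        using eventually_ge_at_top[of M]
        by eventually_elim (use that M seq_suble[OF r] order_trans in blast)
    qed simp
    show "\<exists>d>0. \<forall>y\<in>{0..T}. dist y x < d \<longrightarrow> dist (f y) (f x) < e"
    proof (intro exI[of _ d] conjI ballI impI d)
      fix y assume "y \<in> {0..T}" "dist y x < d"
      then have "norm (f y - f x) \<le> e/2"
        using le[of x y] le[of y x] x by (cases "x \<le> y") (auto simp: dist_real_def norm_minus_commute)
      then show "dist (f y) (f x) < e"
        using e by (simp add: dist_norm)
    qed
  qed
  moreover have "(\<lambda>n. F (r (k n)) (u n)) \<longlonglongrightarrow> f w"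
    if k: "strict_mono (k :: nat \<Rightarrow> nat)" and u: "\<And>n. u n \<in> {0..T}" and w: "w \<in> {0..T}" and lim: "u \<longlonglongrightarrow> w" for k u w
  proof -
    have "(\<lambda>n. F (r (k n)) w) \<longlonglongrightarrow> f w"
      using LIMSEQ_subseq_LIMSEQ[OF f[OF w] k] by (simp add: o_def)
    moreover have "(\<lambda>n. F (r (k n)) (u n) - F (r (k n)) w) \<longlonglongrightarrow> 0"
    proof (rule metric_LIMSEQ_I)
      fix e :: real assume e: "e > 0"
      obtain d M where d: "d > 0" and M: "\<And>n s t. n \<ge> M \<Longrightarrow> 0 \<le> s \<Longrightarrow> s \<le> t \<Longrightarrow> t \<le> T \<Longrightarrow> t - s \<le> d
               \<Longrightarrow> norm (F n t - F n s) \<le> e/2"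
        using equi[of "e/2", OF divide_pos_pos[OF e zero_less_numeral]] by blast
      obtain M' where M': "\<And>n. n \<ge> M' \<Longrightarrow> dist (u n) w < d"
        using metric_LIMSEQ_D[OF lim d] by blast
      show "\<exists>M. \<forall>n\<ge>M. dist (F (r (k n)) (u n) - F (r (k n)) w) 0 < e"
      proof (intro exI allI impI)
        fix n assume n: "n \<ge> max M M'"
        then have "r (k n) \<ge> M"
          using seq_suble[OF k, of n] seq_suble[OF r, of "k n"] by linarith
        then have "norm (F (r (k n)) (u n) - F (r (k n)) w) \<le> e/2"
          using M[of "r (k n)" w "u n"] M[of "r (k n)" "u n" w] M'[of n] n u[of n] w
          by (cases "w \<le> u n") (auto simp: dist_real_def norm_minus_commute)
        then show "dist (F (r (k n)) (u n) - F (r (k n)) w) 0 < e"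
          using e by simp
      qed
    qed
    ultimately show ?thesis
      using tendsto_add by fastforce
  qed
  ultimately show thesis
    using that[OF r] by blast
qed

subsection \<open>Stieltjes measures\<close>

text \<open>A point outside the closed set \<open>A\<close> has a neighbourhood missing
  \<open>A\<close>, so it lies in some \<open>{a<..b}\<close> with rational endpoints and
  \<open>F a = F b\<close>. There are countably many such intervals, and each is null.\<close>

lemma AE_interval_measure_in_support:
  fixes F :: "real \<Rightarrow> real"
  assumes mono: "\<And>x y. x \<le> y \<Longrightarrow> F x \<le> F y" and cont: "\<And>x. continuous (at_right x) F"
    and "closed A" and supp: "\<And>a b. F a < F b \<Longrightarrow> A \<inter> {a..b} \<noteq> {}"
  shows "AE s in interval_measure F. s \<in> A"
proof -
  define J where "J = {(a, b). a \<in> \<rat> \<and> b \<in> \<rat> \<and> a \<le> b \<and> F a = F b}"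
  have "countable J"
    by (rule countable_subset[of _ "\<rat> \<times> \<rat>"]) (auto simp: J_def intro: countable_rat)
  have null: "(\<Union>(a, b)\<in>J. {a<..b}) \<in> null_sets (interval_measure F)"
    using \<open>countable J\<close>
    by (intro null_sets_UN')
       (auto simp: J_def null_sets_def emeasure_interval_measure_Ioc[OF _ mono cont])
  have "x \<in> (\<Union>(a, b)\<in>J. {a<..b})" if x: "x \<notin> A" for x
  proof -
    obtain e where e: "e > 0" "ball x e \<subseteq> - A"
      using \<open>closed A\<close> x by (metis ComplI openE open_Compl)
    obtain a where a: "a \<in> \<rat>" "x - e < a" "a < x"
      using Rats_dense_in_real[of "x - e" x] e by auto
    obtain b where b: "b \<in> \<rat>" "x < b" "b < x + e"
      using Rats_dense_in_real[of x "x + e"] e by auto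
    have "{a..b} \<subseteq> ball x e"
      using a b by (auto simp: dist_real_def)
    then have "A \<inter> {a..b} = {}"
      using e by blast
    then have "F a = F b"
      using supp[of a b] mono[of a b] a b by fastforce
    then have "(a, b) \<in> J"
      using a b by (auto simp: J_def)
    then show ?thesis
      using a b by (intro UN_I[of "(a, b)"]) auto
  qed
  then show ?thesis
    by (intro AE_I'[OF null]) auto
qed

lemma set_integrable_interval_measure:
  fixes g :: "real \<Rightarrow> 'b::euclidean_space"
  assumes mono: "\<And>x y. x \<le> y \<Longrightarrow> F x \<le> F y" and cont: "\<And>x. continuous (at_right x) F"
    and g: "continuous_on UNIV g"
  shows "set_integrable (interval_measure F) {a<..b} g"
proof -
  have [measurable]: "g \<in> borel_measurable borel"
    using g by (rule borel_measurable_continuous_onI)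
  have "bounded (g ` {a..b})"
    using g by (intro compact_imp_bounded compact_continuous_image) (auto intro: continuous_on_subset)
  then obtain B where B: "\<And>x. x \<in> {a..b} \<Longrightarrow> norm (g x) \<le> B"
    by (meson bounded_iff imageI)
  show ?thesis
    unfolding set_integrable_def
  proof (rule integrableI_bounded_set[where A = "{a<..b}" and B = B])
    show "emeasure (interval_measure F) {a<..b} < \<infinity>"
      by (simp add: emeasure_interval_measure_Ioc_eq[OF mono cont])
    show "AE x in interval_measure F. x \<in> {a<..b} \<longrightarrow> norm (indicat_real {a<..b} x *\<^sub>R g x) \<le> B"
      using B by auto
  qed auto
qed

text \<open>On short intervals both the integral of \<open>g\<close> and the increment of
  \<open>lam\<close> differ from \<open>(F t - F s) *\<^sub>R g s\<close> by at most
  \<open>e * (F t - F s)\<close>. Chaining bounds the total discrepancy by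
  \<open>2 * e * (F b - F a)\<close>, and \<open>e\<close> is arbitrary.\<close>

lemma set_integral_interval_measure_eqI:
  fixes g lam :: "real \<Rightarrow> 'b::euclidean_space"
  assumes mono: "\<And>x y. x \<le> y \<Longrightarrow> F x \<le> F y" and cont: "\<And>x. continuous (at_right x) F"
    and g: "continuous_on UNIV g" and "a \<le> b"
    and app: "\<And>e. 0 < e \<Longrightarrow> \<exists>d>0. \<forall>s t. a \<le> s \<longrightarrow> s \<le> t \<longrightarrow> t \<le> b \<longrightarrow> t - s \<le> d
       \<longrightarrow> norm (lam t - lam s - (F t - F s) *\<^sub>R g s) \<le> e * (F t - F s)"
  shows "(LINT s:{a<..b}|interval_measure F. g s) = lam b - lam a"
proof -
  let ?M = "interval_measure F"
  define I where "I t = (LINT s:{a<..t}|?M. g s)" for t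
  define D where "D t = I t - lam t" for t
  have int: "set_integrable ?M {u<..v} g" for u v
    by (rule set_integrable_interval_measure[OF mono cont g])
  have split: "I t - I s = (LINT u:{s<..t}|?M. g u)" if "a \<le> s" "s \<le> t" for s t
  proof -
    have "{a<..t} = {a<..s} \<union> {s<..t}"
      using that by auto
    then show ?thesis
      using set_integral_Un[OF _ int int, of a s s t] by (auto simp: I_def)
  qed
  have small: "norm (D b - D a) \<le> 2 * e * (F b - F a)" if e: "e > 0" for e
  proof -
    have "uniformly_continuous_on {a..b} g"
      using g by (intro compact_uniformly_continuous) (auto intro: continuous_on_subset)
    then obtain d1 where d1: "d1 > 0" "\<And>s t. s \<in> {a..b} \<Longrightarrow> t \<in> {a..b} \<Longrightarrow> dist t s < d1 \<Longrightarrow> dist (g t) (g s) < e"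
      unfolding uniformly_continuous_on_def using e by metis
    obtain d2 where d2: "d2 > 0" "\<And>s t. a \<le> s \<Longrightarrow> s \<le> t \<Longrightarrow> t \<le> b \<Longrightarrow> t - s \<le> d2
       \<Longrightarrow> norm (lam t - lam s - (F t - F s) *\<^sub>R g s) \<le> e * (F t - F s)"
      using app[OF e] by blast
    have "norm (D b - D a) \<le> 2 * e * F b - 2 * e * F a"
    proof (rule norm_increment_le_if_locally[OF \<open>a \<le> b\<close>, of "min (d1/2) d2"])
      show "0 < min (d1/2) d2"
        using d1 d2 by simp
      fix s t assume st: "a \<le> s" "s \<le> t" "t \<le> b" "t - s \<le> min (d1/2) d2"
      have fin: "emeasure ?M {s<..t} \<noteq> \<infinity>" and meas: "measure ?M {s<..t} = F t - F s"
        using st by (simp_all add: emeasure_interval_measure_Ioc[OF _ mono cont]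
            measure_interval_measure_Ioc[OF _ mono cont])
      have intc: "set_integrable ?M {s<..t} (\<lambda>u. c)" for c :: 'b
        by (rule set_integrable_interval_measure[OF mono cont]) auto
      have intr: "set_integrable ?M {s<..t} (\<lambda>u. e)"
        by (rule set_integrable_interval_measure[OF mono cont]) auto
      have "norm (LINT u:{s<..t}|?M. g u - g s) \<le> (LINT u:{s<..t}|?M. norm (g u - g s))"
        unfolding set_lebesgue_integral_def
        by (rule order_trans[OF integral_norm_bound]) (simp add: abs_of_nonneg)
      also have "\<dots> \<le> (LINT u:{s<..t}|?M. e)"
      proof (rule set_integral_mono[OF _ intr])
        show "set_integrable ?M {s<..t} (\<lambda>u. norm (g u - g s))"
          by (rule set_integrable_interval_measure[OF mono cont]) (auto intro!: continuous_intros g)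
        fix u assume "u \<in> {s<..t}"
        then have "dist (g u) (g s) < e"
          using st d1(1) by (intro d1) (auto simp: dist_real_def)
        then show "norm (g u - g s) \<le> e"
          by (simp add: dist_norm)
      qed
      also have "\<dots> = (F t - F s) * e"
        using fin meas by (subst set_integral_const) auto
      finally have "norm (I t - I s - (F t - F s) *\<^sub>R g s) \<le> e * (F t - F s)"
        using split[OF st(1,2)] int intc fin meas by (simp add: set_integral_const mult.commute)
      moreover have "norm (lam t - lam s - (F t - F s) *\<^sub>R g s) \<le> e * (F t - F s)"
        using st by (intro d2) auto
      moreover have eq: "D t - D s = (I t - I s - (F t - F s) *\<^sub>R g s) - (lam t - lam s - (F t - F s) *\<^sub>R g s)"
        by (simp add: D_def)
      ultimately have "norm (D t - D s) \<le> e * (F t - F s) + e * (F t - F s)"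
        unfolding eq by - (rule norm_triangle_le_diff, rule add_mono)
      then show "norm (D t - D s) \<le> 2 * e * F t - 2 * e * F s"
        by (simp add: algebra_simps)
    qed
    then show ?thesis
      by (simp add: algebra_simps)
  qed
  have "norm (D b - D a) \<le> 0"
  proof (rule tendsto_lowerbound[where F = "at_right 0"])
    show "((\<lambda>e. 2 * e * (F b - F a)) \<longlongrightarrow> 0) (at_right 0)"
      by (auto intro!: tendsto_eq_intros)
    show "\<forall>\<^sub>F e in at_right 0. norm (D b - D a) \<le> 2 * e * (F b - F a)"
      using small by (auto simp: eventually_at_filter intro!: always_eventually)
  qed simp
  moreover have "I a = 0"
    by (simp add: I_def set_lebesgue_integral_def)
  ultimately show ?thesis
    by (simp add: D_def I_def algebra_simps)
qed

text \<open>Reduces the problem to a candidate \<open>L\<close> for the total variation. Since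
  \<open>gamma\<close> has unit length, \<open>app\<close> bounds increments of \<open>lam\<close>
  below by \<open>(1 - e)\<close> times those of \<open>L\<close>; with \<open>inc\<close> this
  makes \<open>L\<close> the total variation. The same estimate identifies \<open>lam\<close> as the
  integral of \<open>gamma\<close> along the path, and \<open>supp\<close> concentrates
  \<open>dL\<close> on the contact times.\<close>

lemma skorohod_solutionI:
  fixes gamma :: "real \<times> 'a::euclidean_space \<Rightarrow> 'a"
  assumes "0 < T" and phi: "continuous_on {0..T} phi" and lam: "continuous_on {0..T} lam"
    and decomp: "\<And>t. t \<in> {0..T} \<Longrightarrow> phi t = psi t + lam t"
    and inside: "\<And>t. t \<in> {0..T} \<Longrightarrow> phi t \<in> closure (tsection Om t)"
    and L: "continuous_on {0..T} L" and zero: "L 0 = 0" "lam 0 = 0"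
    and gam: "continuous_on {0..T} (\<lambda>s. gamma (s, phi s))"
    and norm_gam: "\<And>s. s \<in> {0..T} \<Longrightarrow> norm (gamma (s, phi s)) = 1"
    and inc: "\<And>s t. 0 \<le> s \<Longrightarrow> s \<le> t \<Longrightarrow> t \<le> T \<Longrightarrow> norm (lam t - lam s) \<le> L t - L s"
    and app: "\<And>e. 0 < e \<Longrightarrow> \<exists>d>0. \<forall>s t. 0 \<le> s \<longrightarrow> s \<le> t \<longrightarrow> t \<le> T \<longrightarrow> t - s \<le> d
       \<longrightarrow> norm (lam t - lam s - (L t - L s) *\<^sub>R gamma (s, phi s)) \<le> e * (L t - L s)"
    and closed: "closed {s \<in> {0..T}. phi s \<in> frontier (tsection Om s)}"
    and supp: "\<And>s t. 0 \<le> s \<Longrightarrow> s \<le> t \<Longrightarrow> t \<le> T \<Longrightarrow> L s < L t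
       \<Longrightarrow> \<exists>u\<in>{s..t}. phi u \<in> frontier (tsection Om u)"
  shows "skorohod_solution T Om gamma psi phi lam"
proof -
  \<comment> \<open>Clamping time to \<open>{0..T}\<close> reproduces the constant extension in
    \<open>tv_fun\<close>, so that \<open>F\<close> is exactly \<open>tv_fun T lam\<close>. It also
    makes \<open>g\<close> continuous on the whole line, hence Borel; \<open>g\<close> need agree
    with \<open>gamma (s, phi s)\<close> only on \<open>A\<close>, which has full measure.\<close>
  define cl where "cl t = max 0 (min t T)" for t
  define F where "F t = L (cl t)" for t
  define g where "g t = gamma (cl t, phi (cl t))" for t
  define A where "A = {s \<in> {0..T}. phi s \<in> frontier (tsection Om s)}"
  have cl: "cl t \<in> {0..T}" "t \<in> {0..T} \<Longrightarrow> cl t = t" and cl_mono: "s \<le> t \<Longrightarrow> cl s \<le> cl t" for s t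
    using \<open>0 < T\<close> by (auto simp: cl_def)
  have cont_cl: "continuous_on UNIV cl"
    unfolding cl_def by (intro continuous_intros)
  have "continuous_on UNIV F" and contg: "continuous_on UNIV g"
    unfolding F_def g_def
    using continuous_on_compose2[OF L cont_cl image_subsetI]
      continuous_on_compose2[OF gam cont_cl image_subsetI] cl(1) by blast+
  then have cont: "continuous (at_right x) F" for x
    by (auto simp: continuous_on_eq_continuous_at intro: continuous_at_imp_continuous_at_within)
  have Lmono: "L s \<le> L t" if "0 \<le> s" "s \<le> t" "t \<le> T" for s t
    using inc[OF that] norm_ge_zero[of "lam t - lam s"] by linarith
  then have mono: "F x \<le> F y" if "x \<le> y" for x y
    using cl[of x] cl[of y] cl_mono[OF that] by (auto simp: F_def)
  have tv: "total_variation lam 0 t = ereal (L t)" if t: "t \<in> {0..T}" for t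
  proof -
    have "total_variation lam 0 t = ereal (L t - L 0)"
    proof (rule total_variation_eqI)
      fix e :: real assume "0 < e"
      then obtain d where d: "d > 0" "\<And>s t. 0 \<le> s \<Longrightarrow> s \<le> t \<Longrightarrow> t \<le> T \<Longrightarrow> t - s \<le> d
         \<Longrightarrow> norm (lam t - lam s - (L t - L s) *\<^sub>R gamma (s, phi s)) \<le> e * (L t - L s)"
        using app by blast
      have "(1 - e) * (L v - L u) \<le> norm (lam v - lam u)" if "0 \<le> u" "u \<le> v" "v \<le> t" "v - u \<le> d" for u v
      proof -
        have "norm ((L v - L u) *\<^sub>R gamma (u, phi u)) = L v - L u"
          using norm_gam[of u] Lmono[of u v] that t by simp
        moreover have "norm (lam v - lam u - (L v - L u) *\<^sub>R gamma (u, phi u)) \<le> e * (L v - L u)"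
          using d that t by auto
        moreover have "norm ((L v - L u) *\<^sub>R gamma (u, phi u))
           \<le> norm (lam v - lam u) + norm (lam v - lam u - (L v - L u) *\<^sub>R gamma (u, phi u))"
          by (metis norm_minus_commute norm_triangle_sub)
        ultimately show ?thesis
          by (simp add: algebra_simps)
      qed
      then show "\<exists>d>0. \<forall>s ta. 0 \<le> s \<longrightarrow> s \<le> ta \<longrightarrow> ta \<le> t \<longrightarrow> ta - s \<le> d
          \<longrightarrow> (1 - e) * (L ta - L s) \<le> norm (lam ta - lam s)"
        using d(1) by blast
    qed (use t inc in auto)
    then show ?thesis
      by (simp add: zero)
  qed
  have tvF: "tv_fun T lam = F"
    using tv cl(1) by (auto simp: tv_fun_def F_def simp flip: cl_def)
  have F: "F t = L t" if "t \<in> {0..T}" for t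
    using that by (simp add: F_def cl)
  have AE: "AE s in interval_measure F. s \<in> A"
  proof (rule AE_interval_measure_in_support[OF mono cont])
    show "closed A"
      unfolding A_def by (rule closed)
    fix a b assume less: "F a < F b"
    \<comment> \<open>Strictness gives \<open>a < T\<close> and \<open>0 < b\<close>, hence
      \<open>a \<le> cl a\<close> and \<open>cl b \<le> b\<close>: a contact time between the
      clamped endpoints lies in \<open>{a..b}\<close>.\<close>
    then have "cl a < cl b"
      using less Lmono[of "cl b" "cl a"] cl(1)[of a] cl(1)[of b] by (fastforce simp: F_def not_le[symmetric])
    moreover from this obtain u where "u \<in> {cl a..cl b}" "phi u \<in> frontier (tsection Om u)"
      using supp[of "cl a" "cl b"] less cl(1)[of a] cl(1)[of b] by (auto simp: F_def)
    ultimately have "u \<in> A \<inter> {a..b}"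
      using cl(1)[of a] cl(1)[of b] by (auto simp: A_def cl_def max_def min_def split: if_splits)
    then show "A \<inter> {a..b} \<noteq> {}"
      by blast
  qed
  have "tv_fun T lam t = (LINT s:{0<..t}|tv_measure T lam.
          indicator {s. phi s \<in> frontier (tsection Om s)} s)" if t: "t \<in> {0..T}" for t
  proof -
    have "(LINT s:{0<..t}|interval_measure F. indicator {s. phi s \<in> frontier (tsection Om s)} s)
       = (LINT s:{0<..t}|interval_measure F. indicator A s :: real)"
      using t by (intro set_lebesgue_integral_cong) (auto simp: A_def indicator_def)
    also have "\<dots> = (LINT s:{0<..t}|interval_measure F. 1)"
    proof (rule set_lebesgue_integral_cong_AE)
      have [measurable]: "A \<in> sets borel"
        unfolding A_def using closed by (rule borel_closed)
      show "(indicator A :: real \<Rightarrow> real) \<in> borel_measurable (interval_measure F)"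
        by measurable
      show "AE s\<in>{0<..t} in interval_measure F. indicator A s = (1::real)"
        using AE by eventually_elim simp
    qed auto
    also have "\<dots> = F t - F 0"
      using t by (simp add: set_integral_const measure_interval_measure_Ioc[OF _ mono cont]
          emeasure_interval_measure_Ioc[OF _ mono cont])
    finally show ?thesis
      using zero t \<open>0 < T\<close> by (simp add: tv_measure_def tvF F)
  qed
  moreover have "\<exists>ghat. ghat \<in> borel_measurable borel \<and>
        (AE s in tv_measure T lam. ghat s = gamma (s, phi s)) \<and>
        (\<forall>t\<in>{0..T}. set_integrable (tv_measure T lam) {0<..t} ghat \<and>
                     lam t = (LINT s:{0<..t}|tv_measure T lam. ghat s))"
  proof (intro exI[of _ g] conjI ballI)
    show "g \<in> borel_measurable borel"
      using contg by (rule borel_measurable_continuous_onI)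
    show "AE s in tv_measure T lam. g s = gamma (s, phi s)"
      using AE unfolding tv_measure_def tvF
      by eventually_elim (auto simp: A_def g_def cl)
    fix t assume t: "t \<in> {0..T}"
    show "set_integrable (tv_measure T lam) {0<..t} g"
      unfolding tv_measure_def tvF by (rule set_integrable_interval_measure[OF mono cont contg])
    have "(LINT s:{0<..t}|interval_measure F. g s) = lam t - lam 0"
    proof (rule set_integral_interval_measure_eqI[OF mono cont contg])
      fix e :: real assume "0 < e"
      then obtain d where d: "d > 0" "\<And>s t. 0 \<le> s \<Longrightarrow> s \<le> t \<Longrightarrow> t \<le> T \<Longrightarrow> t - s \<le> d
         \<Longrightarrow> norm (lam t - lam s - (L t - L s) *\<^sub>R gamma (s, phi s)) \<le> e * (L t - L s)"
        using app by blast
      then have "norm (lam v - lam u - (F v - F u) *\<^sub>R g u) \<le> e * (F v - F u)"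
        if "0 \<le> u" "u \<le> v" "v \<le> t" "v - u \<le> d" for u v
        using d(2)[of u v] that t by (simp add: F g_def cl)
      then show "\<exists>d>0. \<forall>s ta. 0 \<le> s \<longrightarrow> s \<le> ta \<longrightarrow> ta \<le> t \<longrightarrow> ta - s \<le> d
        \<longrightarrow> norm (lam ta - lam s - (F ta - F s) *\<^sub>R g s) \<le> e * (F ta - F s)"
        using d(1) by blast
    qed (use t in auto)
    then show "lam t = (LINT s:{0<..t}|tv_measure T lam. g s)"
      by (simp add: zero tv_measure_def tvF)
  qed
  ultimately show ?thesis
    using phi lam decomp inside tv[of T] zero \<open>0 < T\<close>
    by (auto simp: skorohod_solution_def)
qed

subsection \<open>Domains moving continuously with an exterior cone condition\<close>

lemma infdist_lessE:
  assumes "infdist x A < e" "A \<noteq> {}"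
  obtains y where "y \<in> A" "dist x y < e"
  using assms by (auto simp: infdist_notempty cINF_less_iff)

lemma connected_Int_frontier_ray:
  fixes y v :: "'a::real_normed_vector"
  assumes "y \<notin> D" "y + l *\<^sub>R v \<in> D" "0 \<le> l"
  obtains l' where "0 \<le> l'" "l' \<le> l" "y + l' *\<^sub>R v \<in> frontier D"
proof -
  let ?S = "(\<lambda>l. y + l *\<^sub>R v) ` {0..l}"
  have "connected ?S"
    by (intro connected_continuous_image continuous_intros) auto
  moreover have "y \<in> ?S" "y + l *\<^sub>R v \<in> ?S"
    using assms(3) by (force intro: image_eqI[of _ _ 0])+
  ultimately have "?S \<inter> frontier D \<noteq> {}"
    using assms(1,2) by (intro connected_Int_frontier) auto
  then show thesis
    using that by auto
qed

text \<open>At a first exit parameter \<open>c\<close> the point is a limit of points of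
  \<open>D\<close> but, \<open>D\<close> being open, lies on its frontier. By \<open>behind\<close>
  the points just before it are already outside \<open>D\<close>, contradicting that
  \<open>c\<close> is the first exit.\<close>

lemma open_ray_stays:
  fixes w u :: "'a::real_normed_vector"
  assumes "open D" "w \<in> D" "0 \<le> l"
    and behind: "\<And>c. 0 < c \<Longrightarrow> c \<le> l \<Longrightarrow> w + c *\<^sub>R u \<in> frontier D
       \<Longrightarrow> \<exists>b>0. \<forall>z. 0 < z \<longrightarrow> z \<le> b \<longrightarrow> w + (c - z) *\<^sub>R u \<notin> D"
  shows "w + l *\<^sub>R u \<in> D"
proof (rule ccontr)
  assume out: "w + l *\<^sub>R u \<notin> D"
  define Z where "Z = {0..l} \<inter> (\<lambda>c. w + c *\<^sub>R u) -` (- D)"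
  have "closed Z"
    unfolding Z_def using \<open>open D\<close>
    by (intro continuous_closed_preimage continuous_intros) auto
  moreover have "Z \<noteq> {}" "bdd_below Z"
    using out \<open>0 \<le> l\<close> by (auto simp: Z_def intro: bdd_belowI[of _ 0])
  ultimately have "Inf Z \<in> Z"
    by (intro closed_contains_Inf)
  define c where "c = Inf Z"
  have c: "0 \<le> c" "c \<le> l" "w + c *\<^sub>R u \<notin> D"
    using \<open>Inf Z \<in> Z\<close> by (auto simp: Z_def c_def)
  have below: "w + b *\<^sub>R u \<in> D" if "0 \<le> b" "b < c" for b
    using that c cInf_lower[OF _ \<open>bdd_below Z\<close>, of b] by (auto simp: Z_def c_def)
  have "c \<noteq> 0"
    using c \<open>w \<in> D\<close> by auto
  then have "0 < c"
    using c by simp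
  have "w + c *\<^sub>R u \<in> closure D"
  proof (rule Lim_in_closed_set[OF closed_closure])
    show "((\<lambda>b. w + b *\<^sub>R u) \<longlongrightarrow> w + c *\<^sub>R u) (at_left c)"
      by (intro tendsto_intros)
    have "\<forall>\<^sub>F b in at_left c. b \<in> {0<..<c}"
      using \<open>0 < c\<close> by (rule eventually_at_leftI[rotated]) auto
    then show "\<forall>\<^sub>F b in at_left c. w + b *\<^sub>R u \<in> closure D"
      by eventually_elim (use below closure_subset[of D] in \<open>auto simp: less_imp_le\<close>)
  qed simp
  then have "w + c *\<^sub>R u \<in> frontier D"
    using c \<open>open D\<close> by (simp add: frontier_def interior_open)
  then obtain b where b: "b > 0" "\<And>z. 0 < z \<Longrightarrow> z \<le> b \<Longrightarrow> w + (c - z) *\<^sub>R u \<notin> D"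
    using behind \<open>0 < c\<close> c by blast
  then show False
    using below[of "c - min b c"] b(2)[of "min b c"] \<open>0 < c\<close> by auto
qed

text \<open>The setting in terms of sections \<open>D t\<close>. \<open>closed_compl\<close>
  expresses that the space-time domain is open relative to the slab over \<open>{0..T}\<close>.
  \<open>cone\<close> expresses that the balls of radius \<open>z * rho\<close> about the points
  \<open>x - z *\<^sub>R gamma (t, x)\<close> miss \<open>D t\<close>, in the form of a distance
  bound.\<close>

locale moving_domain =
  fixes T rho :: real and D :: "real \<Rightarrow> 'a::euclidean_space set"
    and gamma :: "real \<times> 'a \<Rightarrow> 'a" and psi :: "real \<Rightarrow> 'a"
  assumes T_pos: "0 < T" and rho_pos: "0 < rho"
    and bounded_D: "bounded (\<Union>t\<in>{0..T}. D t)"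
    and nonempty_D: "t \<in> {0..T} \<Longrightarrow> D t \<noteq> {}"
    and open_D: "t \<in> {0..T} \<Longrightarrow> open (D t)"
    and closed_compl: "closed {(t, x). t \<in> {0..T} \<and> x \<notin> D t}"
    and cont_infdist: "continuous_on {0..T} (\<lambda>t. infdist x (D t))"
    and cont_gamma: "continuous_on ({0..T} \<times> UNIV) gamma"
    and norm_gamma: "t \<in> {0..T} \<Longrightarrow> norm (gamma (t, x)) = 1"
    and cone: "t \<in> {0..T} \<Longrightarrow> x \<in> frontier (D t) \<Longrightarrow> 0 < z \<Longrightarrow> z \<le> rho
      \<Longrightarrow> y \<in> D t \<Longrightarrow> z * rho \<le> dist (x - z *\<^sub>R gamma (t, x)) y"
    and cont_psi: "continuous_on {0..T} psi"
    and psi_0: "psi 0 \<in> closure (D 0)"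
begin

lemma infdist_eq_0_iff: "t \<in> {0..T} \<Longrightarrow> infdist x (D t) = 0 \<longleftrightarrow> x \<in> closure (D t)"
  using in_closure_iff_infdist_zero[OF nonempty_D] by blast

lemma frontier_subset_closure: "x \<in> frontier (D t) \<Longrightarrow> x \<in> closure (D t)"
  by (simp add: frontier_def)

section \<open>Joint continuity and uniform moduli\<close>

lemma bounded_infdist:
  obtains R where "0 < R" "\<And>t x. t \<in> {0..T} \<Longrightarrow> infdist x (D t) \<le> 1 \<Longrightarrow> norm x \<le> R"
proof -
  obtain R where R: "0 < R" "\<And>t x. t \<in> {0..T} \<Longrightarrow> x \<in> D t \<Longrightarrow> norm x \<le> R"
    using bounded_D unfolding bounded_pos by auto
  show thesis
  proof
    show "0 < R + 2" using R by simp
    fix t x assume t: "t \<in> {0..T}" and "infdist x (D t) \<le> 1"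
    then obtain y where "y \<in> D t" "dist x y < 2"
      using infdist_lessE[OF _ nonempty_D[OF t], of x 2] by auto
    then show "norm x \<le> R + 2"
      using R(2)[OF t, of y] norm_triangle_sub[of x y] by (simp add: dist_norm)
  qed
qed

text \<open>The distance is 1-Lipschitz in \<open>x\<close> for every \<open>t\<close>, so
  continuity in \<open>t\<close> at fixed \<open>x\<close> is enough.\<close>

lemma infdist_jointly_continuous: "continuous_on ({0..T} \<times> UNIV) (\<lambda>(t, x). infdist x (D t))"
  unfolding continuous_on_iff
proof (intro ballI allI impI, clarify)
  fix t x and e :: real assume t: "t \<in> {0..T}" and e: "0 < e"
  obtain d where d: "d > 0" "\<And>s. s \<in> {0..T} \<Longrightarrow> dist s t < d \<Longrightarrow> dist (infdist x (D s)) (infdist x (D t)) < e/2"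
    using cont_infdist[of x] t half_gt_zero[OF e] unfolding continuous_on_iff by metis
  show "\<exists>d>0. \<forall>p\<in>{0..T} \<times> UNIV. dist p (t, x) < d
      \<longrightarrow> dist (case p of (t, x) \<Rightarrow> infdist x (D t)) (infdist x (D t)) < e"
  proof (intro exI[of _ "min d (e/2)"] conjI ballI impI, goal_cases)
    case 1
    then show ?case using d e by simp
  next
    case (2 p)
    then obtain s y where p: "p = (s, y)" "s \<in> {0..T}" by auto
    have "dist s t < d" "dist y x < e/2"
      using 2 dist_fst_le[of p "(t, x)"] dist_snd_le[of p "(t, x)"] by (auto simp: p)
    then have "\<bar>infdist x (D s) - infdist x (D t)\<bar> < e/2"
      using d(2)[OF p(2)] by (simp only: dist_real_def)
    then have "\<bar>infdist y (D s) - infdist x (D t)\<bar> < e"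
      using infdist_triangle_abs[of y "D s" x] \<open>dist y x < e/2\<close> by linarith
    then show ?case
      by (simp add: p dist_real_def)
  qed
qed

text \<open>For open \<open>D t\<close> the frontier is the closure minus \<open>D t\<close>. The
  graph of the closures is the zero set of the jointly continuous distance, and the complement is
  closed by \<open>closed_compl\<close>.\<close>

lemma closed_frontier_graph: "closed {(t, x). t \<in> {0..T} \<and> x \<in> frontier (D t)}"
proof -
  have "closed (({0..T} \<times> UNIV) \<inter> (\<lambda>(t, x). infdist x (D t)) -` {0})"
    by (intro continuous_closed_preimage infdist_jointly_continuous closed_Times) auto
  moreover have "{(t, x). t \<in> {0..T} \<and> x \<in> frontier (D t)}
     = (({0..T} \<times> UNIV) \<inter> (\<lambda>(t, x). infdist x (D t)) -` {0}) \<inter> {(t, x). t \<in> {0..T} \<and> x \<notin> D t}"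
    using open_D by (auto simp: frontier_def interior_open infdist_eq_0_iff)
  ultimately show ?thesis
    using closed_compl by (simp add: closed_Int)
qed

text \<open>Uniform continuity on a compact set. Only the base point \<open>x\<close> must be close
  to the domain; the ball has radius \<open>R + 1\<close> so that it also contains \<open>y\<close>,
  which may lie outside.\<close>

lemma gamma_modulus:
  assumes "0 < e"
  obtains d where "0 < d" "\<And>s t x y. s \<in> {0..T} \<Longrightarrow> t \<in> {0..T} \<Longrightarrow> infdist x (D s) \<le> 1
    \<Longrightarrow> \<bar>t - s\<bar> \<le> d \<Longrightarrow> norm (y - x) \<le> d \<Longrightarrow> norm (gamma (t, y) - gamma (s, x)) \<le> e"
proof -
  obtain R where R: "0 < R" "\<And>t x. t \<in> {0..T} \<Longrightarrow> infdist x (D t) \<le> 1 \<Longrightarrow> norm x \<le> R"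
    using bounded_infdist by blast
  have "uniformly_continuous_on ({0..T} \<times> cball 0 (R + 1)) gamma"
    by (intro compact_uniformly_continuous compact_Times continuous_on_subset[OF cont_gamma]) auto
  then obtain d where d: "d > 0" "\<And>p q. p \<in> {0..T} \<times> cball 0 (R + 1) \<Longrightarrow> q \<in> {0..T} \<times> cball 0 (R + 1)
      \<Longrightarrow> dist q p < d \<Longrightarrow> dist (gamma q) (gamma p) < e"
    unfolding uniformly_continuous_on_def using assms by metis
  show thesis
  proof
    show "0 < min 1 (d/3)" using d by simp
    fix s t x y
    assume st: "s \<in> {0..T}" "t \<in> {0..T}" and x: "infdist x (D s) \<le> 1"
      and near: "\<bar>t - s\<bar> \<le> min 1 (d/3)" "norm (y - x) \<le> min 1 (d/3)"
    have "norm x \<le> R"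
      using R(2)[OF st(1) x] .
    moreover have "norm y \<le> R + 1"
      using \<open>norm x \<le> R\<close> near(2) norm_triangle_sub[of y x] by simp
    moreover have "dist (t, y) (s, x) < d"
      using near d(1) sqrt_sum_squares_le_sum_abs[of "dist t s" "dist y x"]
      by (simp add: dist_Pair_Pair) (simp add: dist_norm)
    ultimately show "norm (gamma (t, y) - gamma (s, x)) \<le> e"
      using d(2)[of "(s, x)" "(t, y)"] st R(1) by (simp add: dist_norm)
  qed
qed

text \<open>Since \<open>s\<close> and \<open>t\<close> are interchangeable, this is continuity of
  the sections in the Hausdorff distance, uniform in time by compactness.\<close>

lemma infdist_modulus:
  assumes "0 < e"
  obtains d where "0 < d" "\<And>s t x. s \<in> {0..T} \<Longrightarrow> t \<in> {0..T} \<Longrightarrow> x \<in> closure (D s)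
    \<Longrightarrow> \<bar>t - s\<bar> \<le> d \<Longrightarrow> infdist x (D t) < e"
proof -
  obtain R where R: "0 < R" "\<And>t x. t \<in> {0..T} \<Longrightarrow> infdist x (D t) \<le> 1 \<Longrightarrow> norm x \<le> R"
    using bounded_infdist by blast
  have "uniformly_continuous_on ({0..T} \<times> cball 0 R) (\<lambda>(t, x). infdist x (D t))"
    by (intro compact_uniformly_continuous compact_Times
        continuous_on_subset[OF infdist_jointly_continuous]) auto
  then obtain d where d: "d > 0" "\<And>p q. p \<in> {0..T} \<times> cball 0 R \<Longrightarrow> q \<in> {0..T} \<times> cball 0 R
      \<Longrightarrow> dist q p < d \<Longrightarrow> dist (case q of (t, x) \<Rightarrow> infdist x (D t)) (case p of (t, x) \<Rightarrow> infdist x (D t)) < e"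
    unfolding uniformly_continuous_on_def using assms by metis
  show thesis
  proof
    show "0 < d/2" using d by simp
    fix s t x
    assume st: "s \<in> {0..T}" "t \<in> {0..T}" and x: "x \<in> closure (D s)" and near: "\<bar>t - s\<bar> \<le> d/2"
    have 0: "infdist x (D s) = 0"
      using x st infdist_eq_0_iff by blast
    then have "norm x \<le> R"
      using R(2)[OF st(1)] by simp
    moreover have "dist (t, x) (s, x) < d"
      using near d(1) by (simp add: dist_Pair_Pair dist_norm)
    ultimately show "infdist x (D t) < e"
      using d(2)[of "(s, x)" "(t, x)"] st 0 infdist_nonneg[of x "D t"] by (simp add: dist_real_def)
  qed
qed

lemma psi_modulus:
  assumes "0 < e"
  obtains d where "0 < d" "\<And>s t. s \<in> {0..T} \<Longrightarrow> t \<in> {0..T} \<Longrightarrow> \<bar>t - s\<bar> \<le> d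
    \<Longrightarrow> norm (psi t - psi s) \<le> e"
proof -
  have "uniformly_continuous_on {0..T} psi"
    by (intro compact_uniformly_continuous cont_psi) auto
  then obtain d where "d > 0" and d: "\<And>p q. p \<in> {0..T} \<Longrightarrow> q \<in> {0..T} \<Longrightarrow> dist q p < d \<Longrightarrow> dist (psi q) (psi p) < e"
    unfolding uniformly_continuous_on_def using assms by metis
  show thesis
  proof
    show "0 < d/2" using \<open>d > 0\<close> by simp
    show "norm (psi t - psi s) \<le> e" if "s \<in> {0..T}" "t \<in> {0..T}" "\<bar>t - s\<bar> \<le> d/2" for s t
      using d[OF that(1,2)] that(3) \<open>d > 0\<close> by (simp add: dist_norm)
  qed
qed

text \<open>A point \<open>y\<close> slightly outside is returned by a short move along
  \<open>gamma (t, y)\<close>. From a point \<open>w\<close> of \<open>D t\<close> near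
  \<open>y\<close>, a ray in a slightly tilted direction cannot leave \<open>D t\<close>: at an exit
  point the exterior cone would contain the part of the ray just before it. The ray ends at
  \<open>y + l0 *\<^sub>R gamma (t, y)\<close>, so the segment from \<open>y\<close> to that point
  meets the frontier.\<close>

lemma push_back:
  assumes "0 < e"
  obtains d where "0 < d" "\<And>t y. t \<in> {0..T} \<Longrightarrow> infdist y (D t) < d
    \<Longrightarrow> \<exists>l. 0 \<le> l \<and> l \<le> e \<and> y + l *\<^sub>R gamma (t, y) \<in> closure (D t)
        \<and> (l = 0 \<or> y + l *\<^sub>R gamma (t, y) \<in> frontier (D t))"
proof -
  obtain c where c: "0 < c" "\<And>s t x y. s \<in> {0..T} \<Longrightarrow> t \<in> {0..T} \<Longrightarrow> infdist x (D s) \<le> 1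
    \<Longrightarrow> \<bar>t - s\<bar> \<le> c \<Longrightarrow> norm (y - x) \<le> c \<Longrightarrow> norm (gamma (t, y) - gamma (s, x)) \<le> rho/2"
    using gamma_modulus[of "rho/2"] rho_pos by auto
  \<comment> \<open>The tilted direction will have norm at most 2, so \<open>l0 \<le> c/4\<close>
    keeps the ray within \<open>c/2\<close> of \<open>w\<close>, and within \<open>c\<close> of
    \<open>y\<close> as \<open>d \<le> c/4\<close>; there \<open>gamma\<close> changes by at most
    \<open>rho/2\<close>.\<close>
  define l0 where "l0 = min e (c/4)"
  have l0: "0 < l0" "l0 \<le> e" "l0 \<le> c/4"
    using assms c by (auto simp: l0_def)
  \<comment> \<open>The last factor makes the tilt \<open>dist y w / l0\<close> smaller than both
    \<open>rho/2\<close> and 1.\<close>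
  define d where "d = min (min 1 (c/4)) (min 1 (rho/2) * l0)"
  have d: "0 < d" "d \<le> 1" "d \<le> c/4" "d \<le> rho/2 * l0" "d \<le> l0"
  proof -
    have "min 1 (rho/2) * l0 \<le> rho/2 * l0" "min 1 (rho/2) * l0 \<le> 1 * l0"
      using l0 by (intro mult_right_mono; simp)+
    moreover have "d \<le> 1" "d \<le> c/4" "d \<le> min 1 (rho/2) * l0"
      unfolding d_def by (auto simp only: min_le_iff_disj order_refl simp_thms)
    moreover have "0 < d"
      using l0 rho_pos c by (simp add: d_def)
    ultimately show "0 < d" "d \<le> 1" "d \<le> c/4" "d \<le> rho/2 * l0" "d \<le> l0"
      by linarith+
  qed
  show thesis
  proof
    show "0 < d" by (rule d)
    fix t y assume t: "t \<in> {0..T}" and y: "infdist y (D t) < d"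
    show "\<exists>l. 0 \<le> l \<and> l \<le> e \<and> y + l *\<^sub>R gamma (t, y) \<in> closure (D t)
        \<and> (l = 0 \<or> y + l *\<^sub>R gamma (t, y) \<in> frontier (D t))"
    proof (cases "y \<in> closure (D t)")
      case True
      then show ?thesis using assms by (intro exI[of _ 0]) auto
    next
      case False
      obtain w where w: "w \<in> D t" "dist y w < d"
        using infdist_lessE[OF y nonempty_D[OF t]] by blast
      define v where "v = gamma (t, y)"
      \<comment> \<open>Chosen so that
        \<open>w + l0 *\<^sub>R u = y + l0 *\<^sub>R v\<close>.\<close>
      define u where "u = v + (1/l0) *\<^sub>R (y - w)"
      have "w + l0 *\<^sub>R u \<in> D t"
      proof (rule open_ray_stays[OF open_D[OF t] w(1) less_imp_le[OF l0(1)]])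
        fix b assume b: "0 < b" "b \<le> l0" and x: "w + b *\<^sub>R u \<in> frontier (D t)"
        let ?x = "w + b *\<^sub>R u"
        have uv: "norm (u - v) < rho/2" "norm (u - v) \<le> 1"
        proof -
          have "norm (u - v) = dist y w / l0"
            using l0 by (simp add: u_def dist_norm)
          also have "\<dots> < d / l0"
            using w l0 by (simp add: divide_strict_right_mono)
          finally have "norm (u - v) < d / l0" .
          moreover have "d / l0 \<le> rho/2" "d / l0 \<le> 1"
            using d l0 by (simp_all add: divide_le_eq)
          ultimately show "norm (u - v) < rho/2" "norm (u - v) \<le> 1"
            by linarith+
        qed
        have "norm v = 1"
          using norm_gamma[OF t] by (simp add: v_def)
        then have "norm u \<le> 2"
          using uv norm_triangle_sub[of u v] by simp
        then have "norm (b *\<^sub>R u) \<le> c/2"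
          using b l0 mult_mono[of b "c/4" "norm u" 2] by simp
        then have "norm (?x - y) \<le> c"
          using w d norm_triangle_ineq[of "w - y" "b *\<^sub>R u"] c(1)
          by (simp add: dist_norm norm_minus_commute algebra_simps)
        then have "norm (gamma (t, ?x) - v) \<le> rho/2"
          unfolding v_def using t y d c(1) by (intro c(2)) auto
        then have ug: "norm (u - gamma (t, ?x)) < rho"
          using uv norm_triangle_ineq4[of "u - v" "gamma (t, ?x) - v"] by simp
        \<comment> \<open>The point at parameter distance \<open>z\<close> before \<open>?x\<close>
          differs from the cone's centre \<open>?x - z *\<^sub>R gamma (t, ?x)\<close> by
          \<open>z * norm (u - gamma (t, ?x))\<close>, which is less than
          \<open>z * rho\<close>.\<close>
        have "w + (b - z) *\<^sub>R u \<notin> D t" if z: "0 < z" "z \<le> rho" for z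
        proof
          assume "w + (b - z) *\<^sub>R u \<in> D t"
          then have "z * rho \<le> dist (?x - z *\<^sub>R gamma (t, ?x)) (w + (b - z) *\<^sub>R u)"
            using cone[OF t x] z by blast
          also have "\<dots> = norm (z *\<^sub>R (u - gamma (t, ?x)))"
            by (simp add: dist_norm algebra_simps)
          also have "\<dots> = z * norm (u - gamma (t, ?x))"
            using z by simp
          finally show False
            using ug z by simp
        qed
        then show "\<exists>b'>0. \<forall>z. 0 < z \<longrightarrow> z \<le> b' \<longrightarrow> w + (b - z) *\<^sub>R u \<notin> D t"
          using rho_pos by blast
      qed
      then have "y + l0 *\<^sub>R v \<in> D t"
        using l0 by (simp add: u_def algebra_simps)
      moreover have "y \<notin> D t"
        using False closure_subset by blast
      ultimately obtain l where "0 \<le> l" "l \<le> l0" "y + l *\<^sub>R v \<in> frontier (D t)"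
        using connected_Int_frontier_ray l0(1) less_imp_le by metis
      then show ?thesis
        using l0 frontier_subset_closure unfolding v_def by (intro exI[of _ l]) auto
    qed
  qed
qed

subsection \<open>The time-stepping scheme\<close>

text \<open>The cap at \<open>T\<close> lets the scheme run over all naturals while its times stay
  in \<open>{0..T}\<close>.\<close>

definition grid :: "real \<Rightarrow> nat \<Rightarrow> real" where
  "grid h k = min T (real k * h)"

text \<open>\<open>q\<close> is the accumulated push, \<open>L\<close> its accumulated length, and
  \<open>psi (grid h k) + q k\<close> the position. The direction of a push is taken at the
  predicted position, where \<open>psi\<close> has moved but the push has not yet happened. A single
  push has length at most \<open>e\<close>, and a nonzero one ends on the frontier. A relation is
  used since push lengths are chosen, not computed.\<close>

definition scheme :: "real \<Rightarrow> real \<Rightarrow> (nat \<Rightarrow> 'a) \<Rightarrow> (nat \<Rightarrow> real) \<Rightarrow> bool" where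
  "scheme h e q L \<longleftrightarrow> q 0 = 0 \<and> L 0 = 0 \<and> (\<forall>k.
     psi (grid h k) + q k \<in> closure (D (grid h k)) \<and>
     L k \<le> L (Suc k) \<and> L (Suc k) - L k \<le> e \<and>
     q (Suc k) = q k + (L (Suc k) - L k) *\<^sub>R gamma (grid h (Suc k), psi (grid h (Suc k)) + q k) \<and>
     (L (Suc k) = L k \<or> psi (grid h (Suc k)) + q (Suc k) \<in> frontier (D (grid h (Suc k)))))"

lemma grid_range: "0 < h \<Longrightarrow> grid h k \<in> {0..T}"
  using T_pos by (simp add: grid_def)

lemma grid_mono: "0 < h \<Longrightarrow> i \<le> j \<Longrightarrow> grid h i \<le> grid h j"
  unfolding grid_def by (intro min.mono mult_right_mono) auto

lemma grid_step: "0 < h \<Longrightarrow> grid h (Suc k) - grid h k \<le> h"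
  by (auto simp: grid_def min_def algebra_simps)

lemma infdist_closure_eq_0: "t \<in> {0..T} \<Longrightarrow> x \<in> closure (D t) \<Longrightarrow> infdist x (D t) = 0"
  using infdist_eq_0_iff by blast

text \<open>For small \<open>h\<close> the prediction stays within \<open>d\<close> of the next
  section: at most \<open>d/2\<close> comes from \<open>psi\<close> and less than \<open>d/2\<close>
  from the motion of the domain. Then \<open>push_back\<close> supplies the next push.\<close>

lemma scheme_exists:
  assumes "0 < e"
  obtains h0 where "0 < h0" "\<And>h. 0 < h \<Longrightarrow> h \<le> h0 \<Longrightarrow> \<exists>q L. scheme h e q L"
proof -
  obtain d where d: "0 < d" "\<And>t y. t \<in> {0..T} \<Longrightarrow> infdist y (D t) < d
    \<Longrightarrow> \<exists>l. 0 \<le> l \<and> l \<le> e \<and> y + l *\<^sub>R gamma (t, y) \<in> closure (D t)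
        \<and> (l = 0 \<or> y + l *\<^sub>R gamma (t, y) \<in> frontier (D t))"
    using push_back[OF assms] by blast
  have d2: "0 < d/2" using d by simp
  obtain d' where d': "0 < d'" "\<And>s t x. s \<in> {0..T} \<Longrightarrow> t \<in> {0..T} \<Longrightarrow> x \<in> closure (D s)
    \<Longrightarrow> \<bar>t - s\<bar> \<le> d' \<Longrightarrow> infdist x (D t) < d/2"
    using infdist_modulus[OF d2] by blast
  obtain d'' where d'': "0 < d''" "\<And>s t. s \<in> {0..T} \<Longrightarrow> t \<in> {0..T} \<Longrightarrow> \<bar>t - s\<bar> \<le> d''
    \<Longrightarrow> norm (psi t - psi s) \<le> d/2"
    using psi_modulus[OF d2] by blast
  show thesis
  proof
    show "0 < min d' d''" using d' d'' by simp
    fix h assume h: "0 < h" "h \<le> min d' d''"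
    \<comment> \<open>States are pairs of push and length; the clause at \<open>k = 0\<close> fixes
      the start of the dependent choice.\<close>
    define P where "P k x \<longleftrightarrow> (k = 0 \<longrightarrow> x = (0, 0)) \<and> psi (grid h k) + fst x \<in> closure (D (grid h k))"
      for k and x :: "'a \<times> real"
    define Q where "Q k x x' \<longleftrightarrow> snd x \<le> snd x' \<and> snd x' - snd x \<le> e \<and>
     fst x' = fst x + (snd x' - snd x) *\<^sub>R gamma (grid h (Suc k), psi (grid h (Suc k)) + fst x) \<and>
     (snd x' = snd x \<or> psi (grid h (Suc k)) + fst x' \<in> frontier (D (grid h (Suc k))))"
      for k and x x' :: "'a \<times> real"
    have "\<exists>f. \<forall>k. P k (f k) \<and> Q k (f k) (f (Suc k))"
    proof (rule dependent_nat_choice)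
      show "\<exists>x. P 0 x"
        using psi_0 T_pos by (intro exI[of _ "(0, 0)"]) (simp add: P_def grid_def)
      fix x k assume "P k x"
      then have x: "psi (grid h k) + fst x \<in> closure (D (grid h k))"
        by (simp add: P_def)
      let ?t = "grid h (Suc k)" and ?s = "grid h k"
      let ?y = "psi ?t + fst x"
      have near: "\<bar>?t - ?s\<bar> \<le> min d' d''"
        using grid_step[OF h(1), of k] grid_mono[OF h(1), of k "Suc k"] h by simp
      have "infdist ?y (D ?t) \<le> infdist (psi ?s + fst x) (D ?t) + dist ?y (psi ?s + fst x)"
        by (rule infdist_triangle)
      also have "\<dots> < d/2 + d/2"
        using d'(2)[OF grid_range[OF h(1)] grid_range[OF h(1)] x] near
          d''(2)[OF grid_range[OF h(1), of k] grid_range[OF h(1), of "Suc k"]]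
        by (intro add_less_le_mono) (auto simp: dist_norm)
      finally have "infdist ?y (D ?t) < d" by simp
      then obtain l where l: "0 \<le> l" "l \<le> e" "?y + l *\<^sub>R gamma (?t, ?y) \<in> closure (D ?t)"
        "l = 0 \<or> ?y + l *\<^sub>R gamma (?t, ?y) \<in> frontier (D ?t)"
        using d(2)[OF grid_range[OF h(1)]] by blast
      then show "\<exists>x'. P (Suc k) x' \<and> Q k x x'"
        by (intro exI[of _ "(fst x + l *\<^sub>R gamma (?t, ?y), snd x + l)"])
           (auto simp: P_def Q_def add.assoc)
    qed
    then obtain f where f: "\<And>k. P k (f k)" "\<And>k. Q k (f k) (f (Suc k))"
      by blast
    have "fst (f 0) = 0" "snd (f 0) = 0"
      using f(1)[of 0] by (simp_all add: P_def)
    then have "scheme h e (\<lambda>k. fst (f k)) (\<lambda>k. snd (f k))"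
      unfolding scheme_def by (intro conjI allI) (use f[unfolded P_def Q_def] in blast)+
    then show "\<exists>q L. scheme h e q L" by blast
  qed
qed

section \<open>Estimates along one run of the scheme\<close>

context
  fixes h e q L
  assumes scheme: "scheme h e q L" and h_pos: "0 < h"
begin

lemma scheme_mono: "i \<le> j \<Longrightarrow> L i \<le> L j"
  by (rule lift_Suc_mono_le[of L]) (use scheme in \<open>auto simp: scheme_def\<close>)

text \<open>Each push differs from its length times \<open>v\<close> by at most \<open>c\<close>
  times its length, and these errors add up.\<close>

lemma scheme_deviation:
  assumes "i \<le> j" "\<And>m. i \<le> m \<Longrightarrow> m < j
      \<Longrightarrow> norm (gamma (grid h (Suc m), psi (grid h (Suc m)) + q m) - v) \<le> c"
  shows "norm (q j - q i - (L j - L i) *\<^sub>R v) \<le> c * (L j - L i)"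
  using assms
proof (induction j rule: dec_induct)
  case base
  then show ?case by simp
next
  case (step j)
  let ?g = "gamma (grid h (Suc j), psi (grid h (Suc j)) + q j)" and ?l = "L (Suc j) - L j"
  have "q (Suc j) = q j + ?l *\<^sub>R ?g"
    using scheme by (auto simp: scheme_def)
  then have "q (Suc j) - q i - (L (Suc j) - L i) *\<^sub>R v
     = (q j - q i - (L j - L i) *\<^sub>R v) + ?l *\<^sub>R (?g - v)"
    by (simp add: algebra_simps)
  also have "norm \<dots> \<le> c * (L j - L i) + ?l * c"
  proof (rule order_trans[OF norm_triangle_ineq add_mono])
    show "norm (q j - q i - (L j - L i) *\<^sub>R v) \<le> c * (L j - L i)"
      using step by auto
    show "norm (?l *\<^sub>R (?g - v)) \<le> ?l * c"
      using step scheme_mono[of j "Suc j"] by (auto intro!: mult_left_mono)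
  qed
  finally show ?case
    by (simp add: algebra_simps)
qed

lemma scheme_increment: "i \<le> j \<Longrightarrow> norm (q j - q i) \<le> L j - L i"
  \<comment> \<open>With \<open>v = 0\<close> the deviation of a unit direction is exactly
    1.\<close>
  using scheme_deviation[of i j 0 1] norm_gamma[OF grid_range[OF h_pos]] by simp

end

text \<open>The central estimate, with \<open>d\<close> independent of the run. It is a bootstrap on
  \<open>j\<close>: if the growth \<open>L j - L i\<close> is at most \<open>r'/2\<close>, one more
  push gives at most \<open>r'\<close>, small enough to use the cone at the new frontier point, and
  the cone brings the bound back below \<open>r'/2\<close>.\<close>

lemma scheme_equicontinuous:
  assumes "0 < r"
  obtains d where "0 < d" "\<And>h e q L i j. scheme h e q L \<Longrightarrow> 0 < h \<Longrightarrow> e \<le> d \<Longrightarrow> i \<le> j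
     \<Longrightarrow> grid h j - grid h i \<le> d \<Longrightarrow> L j - L i \<le> r"
proof -
  have "0 < rho/4" using rho_pos by simp
  then obtain c where c: "0 < c" "\<And>s t x y. s \<in> {0..T} \<Longrightarrow> t \<in> {0..T} \<Longrightarrow> infdist x (D s) \<le> 1
    \<Longrightarrow> \<bar>t - s\<bar> \<le> c \<Longrightarrow> norm (y - x) \<le> c \<Longrightarrow> norm (gamma (t, y) - gamma (s, x)) \<le> rho/4"
    using gamma_modulus by metis
  \<comment> \<open>\<open>r' \<le> rho\<close> admits the growth as a cone parameter, and
    \<open>r' \<le> c/4\<close> with \<open>b \<le> c/4\<close> keeps all positions involved within
    \<open>c\<close> of the new one. The bound \<open>b \<le> rho * r'/8\<close> is what closes the
    bootstrap.\<close>
  define r' where "r' = min r (min rho (c/4))"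
  have r': "0 < r'" "r' \<le> r" "r' \<le> rho" "r' \<le> c/4"
    using assms rho_pos c by (auto simp: r'_def)
  define b where "b = min (c/4) (rho * r'/8)"
  have b: "0 < b" "b \<le> c/4" "b \<le> rho * r'/8"
    using c r' rho_pos by (auto simp: b_def)
  obtain d1 where d1: "0 < d1" "\<And>s t x. s \<in> {0..T} \<Longrightarrow> t \<in> {0..T} \<Longrightarrow> x \<in> closure (D s)
    \<Longrightarrow> \<bar>t - s\<bar> \<le> d1 \<Longrightarrow> infdist x (D t) < b"
    using infdist_modulus[OF b(1)] by blast
  obtain d2 where d2: "0 < d2" "\<And>s t. s \<in> {0..T} \<Longrightarrow> t \<in> {0..T} \<Longrightarrow> \<bar>t - s\<bar> \<le> d2
    \<Longrightarrow> norm (psi t - psi s) \<le> b"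
    using psi_modulus[OF b(1)] by blast
  define d where "d = min (min d1 d2) (min c (r'/2))"
  have d: "0 < d" "d \<le> d1" "d \<le> d2" "d \<le> c" "d \<le> r'/2"
    using d1 d2 c r' by (auto simp: d_def)
  show thesis
  proof
    show "0 < d" by (rule d)
    fix h e q L i j
    assume sch: "scheme h e q L" and h: "0 < h" and e: "e \<le> d"
      and "i \<le> j" "grid h j - grid h i \<le> d"
    from this(4,5) have "L j - L i \<le> r'/2"
    proof (induction j rule: dec_induct)
      case base
      then show ?case using r' by simp
    next
      case (step j)
      let ?t = "grid h (Suc j)" and ?s = "grid h i"
      let ?p = "psi ?t + q (Suc j)"
      let ?v = "gamma (?t, ?p)"
      note in_T = grid_range[OF h]
      have IH: "L j - L i \<le> r'/2"
        using step grid_mono[OF h, of j "Suc j"] by simp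
      define l where "l = L (Suc j) - L i"
      have sj: "L (Suc j) - L j \<le> e" "L (Suc j) = L j \<or> ?p \<in> frontier (D ?t)"
        "psi ?s + q i \<in> closure (D ?s)"
        using sch by (auto simp: scheme_def)
      have l: "0 \<le> l" "l \<le> r'"
        using IH sj(1) e d scheme_mono[OF sch h, of i "Suc j"] step by (auto simp: l_def)
      show ?case
      \<comment> \<open>Without a push the induction hypothesis carries over; otherwise the new
        position lies on the frontier, where the cone is available.\<close>
      proof (cases "L (Suc j) = L j \<or> l = 0")
        case True
        then show ?thesis using IH r' by (auto simp: l_def)
      next
        case False
        then have p: "?p \<in> frontier (D ?t)" and l0: "0 < l"
          using sj l by auto
        have p0: "infdist ?p (D ?t) \<le> 1"
          by (simp add: infdist_closure_eq_0[OF in_T frontier_subset_closure[OF p]])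
        have near: "\<bar>?s - ?t\<bar> \<le> d" "\<bar>?t - ?s\<bar> \<le> d"
          using step grid_mono[OF h, of i "Suc j"] by auto
        \<comment> \<open>All pushes since \<open>i\<close> are compared with the direction at the
          endpoint \<open>?p\<close>, which is in the closure and so a valid base point for the
          modulus of \<open>gamma\<close>.\<close>
        have dev: "norm (q (Suc j) - q i - l *\<^sub>R ?v) \<le> rho/4 * l"
          unfolding l_def
        proof (rule scheme_deviation[OF sch h])
          fix m assume m: "i \<le> m" "m < Suc j"
          have "norm (q (Suc j) - q m) \<le> L (Suc j) - L m"
            using m by (intro scheme_increment[OF sch h]) auto
          also have "\<dots> \<le> l"
            using scheme_mono[OF sch h, of i m] m by (simp add: l_def)
          finally have qm: "norm (q (Suc j) - q m) \<le> c/4"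
            using l r' by simp
          have tm: "\<bar>grid h (Suc m) - ?t\<bar> \<le> d"
            using near grid_mono[OF h, of i "Suc m"] grid_mono[OF h, of "Suc m" "Suc j"] m by auto
          then have "norm (psi (grid h (Suc m)) - psi ?t) \<le> b"
            using d by (intro d2 in_T) auto
          moreover have eq: "psi (grid h (Suc m)) + q m - ?p
            = (psi (grid h (Suc m)) - psi ?t) - (q (Suc j) - q m)"
            by simp
          ultimately have "norm (psi (grid h (Suc m)) + q m - ?p) \<le> b + c/4"
            unfolding eq using qm by - (rule norm_triangle_le_diff, rule add_mono)
          then show "norm (gamma (grid h (Suc m), psi (grid h (Suc m)) + q m) - ?v) \<le> rho/4"
            using tm b c(1) d by (intro c(2)[OF in_T in_T p0]) auto
        qed (use step in auto)
        \<comment> \<open>The position at time \<open>?s\<close> was in the closed section, so a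
          point \<open>z\<close> of the current section is within \<open>b\<close> of it. Going back
          \<open>l\<close> from \<open>?p\<close> against \<open>?v\<close> nearly reaches that old
          position, while the cone keeps \<open>z\<close> at distance
          \<open>l * rho\<close>.\<close>
        have "infdist (psi ?s + q i) (D ?t) < b"
          using near d by (intro d1(2)[OF in_T in_T sj(3)]) auto
        then obtain z where z: "z \<in> D ?t" "dist (psi ?s + q i) z < b"
          using infdist_lessE[OF _ nonempty_D[OF in_T]] by blast
        have "l * rho \<le> dist (?p - l *\<^sub>R ?v) z"
          using l l0 r' by (intro cone[OF in_T p _ _ z(1)]) auto
        also have "\<dots> \<le> dist (?p - l *\<^sub>R ?v) (psi ?s + q i) + dist (psi ?s + q i) z"
          by (rule dist_triangle)
        also have "dist (?p - l *\<^sub>R ?v) (psi ?s + q i)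
            = norm ((psi ?t - psi ?s) + (q (Suc j) - q i - l *\<^sub>R ?v))"
          by (simp add: dist_norm algebra_simps)
        also have "\<dots> \<le> b + rho/4 * l"
        proof (rule norm_triangle_mono[OF _ dev])
          show "norm (psi ?t - psi ?s) \<le> b"
            using near d by (intro d2 in_T) auto
        qed
        finally have "l * rho \<le> 2 * b + rho/4 * l"
          using z by simp
        \<comment> \<open>This yields \<open>l \<le> r'/3\<close>, which is below
          \<open>r'/2\<close>.\<close>
        then have "rho * (3/4 * l) \<le> rho * (r'/4)"
          using b by (simp add: algebra_simps)
        then have "3/4 * l \<le> r'/4"
          using rho_pos by simp
        then show ?thesis
          using r' by (simp add: l_def)
      qed
    qed
    then show "L j - L i \<le> r"
      using r' by simp
  qed
qed

text \<open>Over short times equicontinuity keeps all positions near the initial one, so each push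
  is nearly parallel to \<open>gamma\<close> at the start, and the deviation bound applies.\<close>

lemma scheme_direction:
  assumes "0 < r"
  obtains d where "0 < d" "\<And>h e q L i j. scheme h e q L \<Longrightarrow> 0 < h \<Longrightarrow> e \<le> d \<Longrightarrow> i \<le> j
     \<Longrightarrow> grid h j - grid h i \<le> d
     \<Longrightarrow> norm (q j - q i - (L j - L i) *\<^sub>R gamma (grid h i, psi (grid h i) + q i)) \<le> r * (L j - L i)"
proof -
  obtain c where c: "0 < c" "\<And>s t x y. s \<in> {0..T} \<Longrightarrow> t \<in> {0..T} \<Longrightarrow> infdist x (D s) \<le> 1
    \<Longrightarrow> \<bar>t - s\<bar> \<le> c \<Longrightarrow> norm (y - x) \<le> c \<Longrightarrow> norm (gamma (t, y) - gamma (s, x)) \<le> r"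
    using gamma_modulus[OF assms] by blast
  have c2: "0 < c/2" using c by simp
  obtain d1 where d1: "0 < d1" "\<And>h e q L i j. scheme h e q L \<Longrightarrow> 0 < h \<Longrightarrow> e \<le> d1 \<Longrightarrow> i \<le> j
     \<Longrightarrow> grid h j - grid h i \<le> d1 \<Longrightarrow> L j - L i \<le> c/2"
    using scheme_equicontinuous[OF c2] by blast
  obtain d2 where d2: "0 < d2" "\<And>s t. s \<in> {0..T} \<Longrightarrow> t \<in> {0..T} \<Longrightarrow> \<bar>t - s\<bar> \<le> d2
    \<Longrightarrow> norm (psi t - psi s) \<le> c/2"
    using psi_modulus[OF c2] by blast
  define d where "d = min (min d1 d2) c"
  have d: "0 < d" "d \<le> d1" "d \<le> d2" "d \<le> c"
    using d1 d2 c by (auto simp: d_def)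
  show thesis
  proof
    show "0 < d" by (rule d)
    fix h e q L i j
    assume sch: "scheme h e q L" and h: "0 < h" and e: "e \<le> d"
      and ij: "i \<le> j" "grid h j - grid h i \<le> d"
    note in_T = grid_range[OF h]
    show "norm (q j - q i - (L j - L i) *\<^sub>R gamma (grid h i, psi (grid h i) + q i)) \<le> r * (L j - L i)"
    proof (rule scheme_deviation[OF sch h ij(1)])
      fix m assume m: "i \<le> m" "m < j"
      have tm: "grid h i \<le> grid h m" "grid h m \<le> grid h (Suc m)" "grid h (Suc m) \<le> grid h j"
        using m by (auto intro!: grid_mono[OF h])
      have "norm (q m - q i) \<le> L m - L i"
        using m by (intro scheme_increment[OF sch h]) auto
      also have "\<dots> \<le> c/2"
        using tm ij d e m by (intro d1(2)[OF sch h]) auto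
      finally have "norm (q m - q i) \<le> c/2" .
      moreover have "norm (psi (grid h (Suc m)) - psi (grid h i)) \<le> c/2"
        using tm ij d by (intro d2 in_T) auto
      moreover have eq: "psi (grid h (Suc m)) + q m - (psi (grid h i) + q i)
          = (psi (grid h (Suc m)) - psi (grid h i)) + (q m - q i)"
        by simp
      ultimately have "norm (psi (grid h (Suc m)) + q m - (psi (grid h i) + q i)) \<le> c/2 + c/2"
        unfolding eq by - (rule norm_triangle_mono)
      moreover have "infdist (psi (grid h i) + q i) (D (grid h i)) \<le> 1"
        using sch by (simp add: scheme_def infdist_closure_eq_0[OF in_T])
      ultimately show "norm (gamma (grid h (Suc m), psi (grid h (Suc m)) + q m)
           - gamma (grid h i, psi (grid h i) + q i)) \<le> r"
        using tm ij d by (intro c(2) in_T) auto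
    qed
  qed
qed

subsection \<open>Passage to the limit\<close>

definition idx :: "real \<Rightarrow> real \<Rightarrow> nat" where
  "idx h t = nat \<lfloor>t / h\<rfloor>"

lemma idx_mono: "0 < h \<Longrightarrow> s \<le> t \<Longrightarrow> idx h s \<le> idx h t"
  unfolding idx_def by (intro nat_mono floor_mono divide_right_mono) auto

lemma idx_bounds:
  assumes "0 < h" "0 \<le> t"
  shows "real (idx h t) * h \<le> t" "t < real (Suc (idx h t)) * h"
proof -
  have "0 \<le> \<lfloor>t / h\<rfloor>"
    using assms by simp
  then have "real (idx h t) = of_int \<lfloor>t / h\<rfloor>"
    by (simp add: idx_def)
  then have "real (idx h t) \<le> t / h" "t / h < real (idx h t) + 1"
    by linarith+
  then show "real (idx h t) * h \<le> t" "t < real (Suc (idx h t)) * h"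
    using assms(1) by (simp_all add: field_simps)
qed

lemma idx_multiple: "0 < h \<Longrightarrow> idx h (real m * h) = m"
  by (simp add: idx_def)

lemma grid_idx:
  assumes "0 < h" "t \<in> {0..T}"
  shows "grid h (idx h t) \<le> t" "t - grid h (idx h t) \<le> h"
  using idx_bounds[of h t] assms by (auto simp: grid_def algebra_simps)

lemma ex_skorohod_solution:
  assumes D_eq: "D = tsection Om"
  shows "\<exists>phi lam. skorohod_solution T Om gamma psi phi lam"
proof -
  have "\<exists>h q L. 0 < h \<and> h \<le> 1 / real (Suc n) \<and> scheme h (1 / real (Suc n)) q L" for n
  proof -
    obtain h0 where "0 < h0" "\<And>h. 0 < h \<Longrightarrow> h \<le> h0 \<Longrightarrow> \<exists>q L. scheme h (1 / real (Suc n)) q L"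
      using scheme_exists[of "1 / real (Suc n)"] by auto
    then show ?thesis
      by (intro exI[of _ "min h0 (1 / real (Suc n))"]) auto
  qed
  then obtain h q L where h: "\<And>n. 0 < h n" "\<And>n. h n \<le> 1 / real (Suc n)"
    and sch: "\<And>n. scheme (h n) (1 / real (Suc n)) (q n) (L n)"
    by metis
  have h_lim: "h \<longlonglongrightarrow> 0"
    by (rule real_tendsto_sandwich[OF _ _ tendsto_const LIMSEQ_Suc[OF lim_1_over_n]])
       (use h in \<open>auto simp: less_imp_le intro!: always_eventually\<close>)
  have small: "\<exists>N. \<forall>n\<ge>N. 1 / real (Suc n) \<le> e" if "0 < e" for e
  proof -
    have "\<forall>\<^sub>F n in sequentially. 1 / real (Suc n) < e"
      using LIMSEQ_Suc[OF lim_1_over_n] that by (rule order_tendstoD(2))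
    then show ?thesis
      by (auto simp: eventually_sequentially intro: less_imp_le)
  qed
  \<comment> \<open>The discrete runs become step functions of time, each evaluated at the last grid
    time not after \<open>t\<close>.\<close>
  define tau where "tau n t = grid (h n) (idx (h n) t)" for n t
  define Q where "Q n t = q n (idx (h n) t)" for n t
  define V where "V n t = L n (idx (h n) t)" for n t
  have tau_range: "tau n t \<in> {0..T}" for n t
    unfolding tau_def using grid_range[OF h(1)] .
  have tau_le: "tau n t \<le> t" and tau_ge: "t - tau n t \<le> h n" if "t \<in> {0..T}" for n t
    unfolding tau_def using grid_idx[OF h(1) that] by auto
  have tau_lim: "(\<lambda>n. tau (r n) t) \<longlonglongrightarrow> t" if "t \<in> {0..T}" "strict_mono r" for t r
  proof (rule real_tendsto_sandwich[of "\<lambda>n. t - h (r n)" _ _ "\<lambda>_. t"])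
    have "(\<lambda>n. h (r n)) \<longlonglongrightarrow> 0"
      using LIMSEQ_subseq_LIMSEQ[OF h_lim that(2)] by (simp add: o_def)
    then show "(\<lambda>n. t - h (r n)) \<longlonglongrightarrow> t"
      by (auto intro!: tendsto_eq_intros)
    show "\<forall>\<^sub>F n in sequentially. t - h (r n) \<le> tau (r n) t"
      using tau_ge[OF that(1)] by (simp add: algebra_simps)
  qed (use tau_le that in auto)
  have inc: "norm (Q n t - Q n s) \<le> V n t - V n s" if "s \<le> t" for n s t
    unfolding Q_def V_def by (intro scheme_increment[OF sch h(1)] idx_mono h(1) that)
  \<comment> \<open>Rounding to the grid lengthens a time increment by at most \<open>h n\<close>,
    so \<open>d' = d/2\<close> works once \<open>h n \<le> d/2\<close>.\<close>
  have near: "\<exists>d'>0. \<exists>N. \<forall>n\<ge>N. 1 / real (Suc n) \<le> d \<and>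
      (\<forall>s t. 0 \<le> s \<longrightarrow> s \<le> t \<longrightarrow> t \<le> T \<longrightarrow> t - s \<le> d' \<longrightarrow> tau n t - tau n s \<le> d)" if "0 < d" for d
  proof -
    obtain N where N: "\<And>n. n \<ge> N \<Longrightarrow> 1 / real (Suc n) \<le> d/2"
      using small[OF half_gt_zero[OF \<open>0 < d\<close>]] by blast
    have "tau n t - tau n s \<le> d" if "n \<ge> N" "0 \<le> s" "s \<le> t" "t \<le> T" "t - s \<le> d/2" for n s t
      using tau_le[of t n] tau_ge[of s n] h(2)[of n] N[of n] that by auto
    moreover have "1 / real (Suc n) \<le> d" if "n \<ge> N" for n
      using N[OF that] \<open>0 < d\<close> by linarith
    ultimately show ?thesis
      using \<open>0 < d\<close> by (intro exI[of _ "d/2"] exI[of _ N] conjI) auto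
  qed
  \<comment> \<open>The pair is treated as one function, so that one subsequence serves both
    components; \<open>V\<close> controls \<open>Q\<close>.\<close>
  have equi: "\<exists>d>0. \<exists>N. \<forall>n\<ge>N. \<forall>s t. 0 \<le> s \<longrightarrow> s \<le> t \<longrightarrow> t \<le> T \<longrightarrow> t - s \<le> d
                 \<longrightarrow> norm ((Q n t, V n t) - (Q n s, V n s)) \<le> e" if e: "0 < e" for e
  proof -
    obtain d where d: "0 < d" "\<And>h b q L i j. scheme h b q L \<Longrightarrow> 0 < h \<Longrightarrow> b \<le> d \<Longrightarrow> i \<le> j
       \<Longrightarrow> grid h j - grid h i \<le> d \<Longrightarrow> L j - L i \<le> e/2"
      using scheme_equicontinuous[of "e/2"] e by auto
    obtain d' N where d': "0 < d'" and N: "\<And>n. n \<ge> N \<Longrightarrow> 1 / real (Suc n) \<le> d"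
      "\<And>n s t. n \<ge> N \<Longrightarrow> 0 \<le> s \<Longrightarrow> s \<le> t \<Longrightarrow> t \<le> T \<Longrightarrow> t - s \<le> d' \<Longrightarrow> tau n t - tau n s \<le> d"
      using near[OF d(1)] by blast
    have "norm ((Q n t, V n t) - (Q n s, V n s)) \<le> e"
      if "n \<ge> N" "0 \<le> s" "s \<le> t" "t \<le> T" "t - s \<le> d'" for n s t
    proof -
      have "V n t - V n s \<le> e/2"
        unfolding V_def
        by (rule d(2)[OF sch h(1) N(1)[OF that(1)] idx_mono[OF h(1) that(3)]])
           (use N(2)[OF that] in \<open>simp add: tau_def\<close>)
      moreover have "norm (Q n t - Q n s, V n t - V n s) \<le> norm (Q n t - Q n s) + norm (V n t - V n s)"
        by (rule norm_Pair_le)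
      ultimately show ?thesis
        using inc[OF that(3), of n] norm_ge_zero[of "Q n t - Q n s"] by simp
    qed
    then show ?thesis
      using d' by blast
  qed
  have zero: "(Q n 0, V n 0) = 0" for n
    using sch[of n] by (simp add: Q_def V_def scheme_def idx_def zero_prod_def)
  obtain r :: "nat \<Rightarrow> nat" and f where r: "strict_mono r" and f: "continuous_on {0..T} f"
    and lim: "\<forall>(k :: nat \<Rightarrow> nat) u w. strict_mono k \<longrightarrow> (\<forall>n. u n \<in> {0..T}) \<longrightarrow> w \<in> {0..T} \<longrightarrow> u \<longlonglongrightarrow> w
       \<longrightarrow> (\<lambda>n. (Q (r (k n)) (u n), V (r (k n)) (u n))) \<longlonglongrightarrow> f w"
    by (rule asymptotic_Arzela_Ascoli[of "\<lambda>n t. (Q n t, V n t)" T, OF zero equi])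
  define lam where "lam t = fst (f t)" for t
  define W where "W t = snd (f t)" for t
  define phi where "phi t = psi t + lam t" for t
  have cont_lam: "continuous_on {0..T} lam" and cont_W: "continuous_on {0..T} W"
    unfolding lam_def W_def by (intro continuous_intros f)+
  have cont_phi: "continuous_on {0..T} phi"
    unfolding phi_def by (intro continuous_intros cont_psi cont_lam)
  have limQ: "(\<lambda>n. Q (r (k n)) (u n)) \<longlonglongrightarrow> lam w" and limV: "(\<lambda>n. V (r (k n)) (u n)) \<longlonglongrightarrow> W w"
    if "strict_mono k" "\<And>n. u n \<in> {0..T}" "w \<in> {0..T}" "u \<longlonglongrightarrow> w" for k u w
    using tendsto_fst[OF lim[rule_format, OF that]] tendsto_snd[OF lim[rule_format, OF that]] by (simp_all add: lam_def W_def)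
  have limQ': "(\<lambda>n. Q (r n) t) \<longlonglongrightarrow> lam t" and limV': "(\<lambda>n. V (r n) t) \<longlonglongrightarrow> W t"
    if "t \<in> {0..T}" for t
    using limQ[of id "\<lambda>_. t" t] limV[of id "\<lambda>_. t" t] that by (auto simp: strict_mono_id)
  have psi_lim: "(\<lambda>n. psi (tau (r n) t) + Q (r n) t) \<longlonglongrightarrow> phi t" if "t \<in> {0..T}" for t
    unfolding phi_def
    by (intro tendsto_add limQ' that continuous_on_tendsto_compose[OF cont_psi tau_lim])
       (use that r tau_range in auto)
  have pair_lim: "(\<lambda>n. (tau (r n) t, psi (tau (r n) t) + Q (r n) t)) \<longlonglongrightarrow> (t, phi t)" if "t \<in> {0..T}" for t
    by (intro tendsto_Pair tau_lim psi_lim that r)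
  have "skorohod_solution T Om gamma psi phi lam"
  proof (rule skorohod_solutionI[where L = W])
    show "phi t \<in> closure (tsection Om t)" if t: "t \<in> {0..T}" for t
    proof -
      have "(\<lambda>n. case (tau (r n) t, psi (tau (r n) t) + Q (r n) t) of (t, x) \<Rightarrow> infdist x (D t))
          \<longlonglongrightarrow> (case (t, phi t) of (t, x) \<Rightarrow> infdist x (D t))"
        by (rule continuous_on_tendsto_compose[OF infdist_jointly_continuous pair_lim[OF t]])
           (use t tau_range in auto)
      \<comment> \<open>The approximations lie in the closed sections at the grid times
        \<open>tau n t\<close>, not at \<open>t\<close>; joint continuity of the distance bridges
        the gap.\<close>
      moreover have "infdist (psi (tau n t) + Q n t) (D (tau n t)) = 0" for n
        using infdist_closure_eq_0[OF tau_range] sch[of n] by (auto simp: tau_def Q_def scheme_def)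
      ultimately have "infdist (phi t) (D t) = 0"
        by (simp add: LIMSEQ_const_iff)
      then show ?thesis
        using infdist_eq_0_iff[OF t] by (simp add: D_eq)
    qed
    have "(\<lambda>n. 0) \<longlonglongrightarrow> W 0" "(\<lambda>n. 0) \<longlonglongrightarrow> lam 0"
      using limQ'[of 0] limV'[of 0] zero T_pos by (auto simp: zero_prod_def)
    then show "W 0 = 0" "lam 0 = 0"
      by (simp_all add: LIMSEQ_const_iff)
    show "continuous_on {0..T} (\<lambda>s. gamma (s, phi s))"
      by (intro continuous_on_compose2[OF cont_gamma] continuous_on_Pair cont_phi continuous_on_id) auto
    show "norm (lam t - lam s) \<le> W t - W s" if "0 \<le> s" "s \<le> t" "t \<le> T" for s t
    proof (rule tendsto_le[OF sequentially_bot])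
      show "(\<lambda>n. V (r n) t - V (r n) s) \<longlonglongrightarrow> W t - W s"
        "(\<lambda>n. norm (Q (r n) t - Q (r n) s)) \<longlonglongrightarrow> norm (lam t - lam s)"
        using that by (auto intro!: tendsto_intros limQ' limV')
    qed (use inc that in auto)
    show "\<exists>d>0. \<forall>s t. 0 \<le> s \<longrightarrow> s \<le> t \<longrightarrow> t \<le> T \<longrightarrow> t - s \<le> d
       \<longrightarrow> norm (lam t - lam s - (W t - W s) *\<^sub>R gamma (s, phi s)) \<le> e * (W t - W s)" if e: "0 < e" for e
    proof -
      obtain d where d: "0 < d" "\<And>h b q L i j. scheme h b q L \<Longrightarrow> 0 < h \<Longrightarrow> b \<le> d \<Longrightarrow> i \<le> j
         \<Longrightarrow> grid h j - grid h i \<le> d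
         \<Longrightarrow> norm (q j - q i - (L j - L i) *\<^sub>R gamma (grid h i, psi (grid h i) + q i)) \<le> e * (L j - L i)"
        using scheme_direction[OF e] by blast
      obtain d' N where d': "0 < d'" and N: "\<And>n. n \<ge> N \<Longrightarrow> 1 / real (Suc n) \<le> d"
        "\<And>n s t. n \<ge> N \<Longrightarrow> 0 \<le> s \<Longrightarrow> s \<le> t \<Longrightarrow> t \<le> T \<Longrightarrow> t - s \<le> d' \<Longrightarrow> tau n t - tau n s \<le> d"
        using near[OF d(1)] by blast
      have "norm (lam t - lam s - (W t - W s) *\<^sub>R gamma (s, phi s)) \<le> e * (W t - W s)"
        if st: "0 \<le> s" "s \<le> t" "t \<le> T" "t - s \<le> d'" for s t
      proof (rule tendsto_le[OF sequentially_bot])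
        have in_T: "s \<in> {0..T}" "t \<in> {0..T}"
          using st by auto
        have "(\<lambda>n. gamma (tau (r n) s, psi (tau (r n) s) + Q (r n) s)) \<longlonglongrightarrow> gamma (s, phi s)"
          by (rule continuous_on_tendsto_compose[OF cont_gamma pair_lim]) (use in_T tau_range in auto)
        then show "(\<lambda>n. norm (Q (r n) t - Q (r n) s - (V (r n) t - V (r n) s) *\<^sub>R
              gamma (tau (r n) s, psi (tau (r n) s) + Q (r n) s)))
            \<longlonglongrightarrow> norm (lam t - lam s - (W t - W s) *\<^sub>R gamma (s, phi s))"
          by (intro tendsto_intros limQ' limV' in_T)
        show "(\<lambda>n. e * (V (r n) t - V (r n) s)) \<longlonglongrightarrow> e * (W t - W s)"
          by (intro tendsto_intros limV' in_T)
        show "\<forall>\<^sub>F n in sequentially. norm (Q (r n) t - Q (r n) s - (V (r n) t - V (r n) s) *\<^sub>R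
              gamma (tau (r n) s, psi (tau (r n) s) + Q (r n) s)) \<le> e * (V (r n) t - V (r n) s)"
          using eventually_ge_at_top[of N]
        proof eventually_elim
          case (elim n)
          then have n: "r n \<ge> N"
            using seq_suble[OF r, of n] by simp
          show ?case
            unfolding Q_def V_def tau_def
            by (rule d(2)[OF sch h(1) N(1)[OF n] idx_mono[OF h(1) st(2)]])
               (use N(2)[OF n st] in \<open>simp add: tau_def\<close>)
        qed
      qed
      then show ?thesis
        using d' by blast
    qed
    show "closed {s \<in> {0..T}. phi s \<in> frontier (tsection Om s)}"
    proof -
      have "closed ({0..T} \<inter> (\<lambda>s. (s, phi s)) -` {(t, x). t \<in> {0..T} \<and> x \<in> frontier (D t)})"
        by (intro continuous_closed_preimage closed_frontier_graph continuous_on_Pair continuous_on_id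
            cont_phi) auto
      also have "{0..T} \<inter> (\<lambda>s. (s, phi s)) -` {(t, x). t \<in> {0..T} \<and> x \<in> frontier (D t)}
          = {s \<in> {0..T}. phi s \<in> frontier (tsection Om s)}"
        by (auto simp: D_eq)
      finally show ?thesis .
    qed
    show "\<exists>u\<in>{s..t}. phi u \<in> frontier (tsection Om u)"
      if st: "0 \<le> s" "s \<le> t" "t \<le> T" and less: "W s < W t" for s t
    proof -
      have "\<forall>\<^sub>F n in sequentially. 0 < V (r n) t - V (r n) s"
        by (rule order_tendstoD(1)[OF tendsto_diff[OF limV' limV']]) (use st less in auto)
      then obtain N where N: "\<And>n. n \<ge> N \<Longrightarrow> V (r n) s < V (r n) t"
        by (auto simp: eventually_sequentially)
      \<comment> \<open>Growth of \<open>V n\<close> on \<open>{s..t}\<close> requires a nonzero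
        push at some grid time in between, which ends on the frontier.\<close>
      have contact: "\<exists>u\<in>{s..t}. psi u + Q n u \<in> frontier (D u)" if V: "V n s < V n t" for n
      proof -
        have "\<exists>m. idx (h n) s \<le> m \<and> m < idx (h n) t \<and> L n (Suc m) \<noteq> L n m"
        proof (rule ccontr)
          assume const: "\<not> ?thesis"
          have "L n j = L n (idx (h n) s)" if "idx (h n) s \<le> j" "j \<le> idx (h n) t" for j
            using that by (induction j rule: dec_induct) (use const in auto)
          from this[of "idx (h n) t"] show False
            using V idx_mono[OF h(1) st(2)] by (simp add: V_def)
        qed
        then obtain m where m: "idx (h n) s \<le> m" "m < idx (h n) t" "L n (Suc m) \<noteq> L n m"
          by blast
        \<comment> \<open>The push from index \<open>m\<close> to \<open>Suc m\<close> happens at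
          the later grid time. As \<open>u \<le> t \<le> T\<close>, the cap in \<open>grid\<close>
          is inactive, and \<open>Q n u\<close> is the value after the push.\<close>
        define u where "u = real (Suc m) * h n"
        have "u \<le> real (idx (h n) t) * h n"
          unfolding u_def using m h(1)[of n] by (intro mult_right_mono) auto
        then have "u \<le> t"
          using idx_bounds(1)[OF h(1), of t n] st by simp
        have "real (Suc (idx (h n) s)) * h n \<le> u"
          unfolding u_def using m h(1)[of n] by (intro mult_right_mono) auto
        then have "s \<le> u"
          using idx_bounds(2)[OF h(1), of s n] st by simp
        have "grid (h n) (Suc m) = u"
          using \<open>u \<le> t\<close> st by (simp add: grid_def u_def)
        moreover have "Q n u = q n (Suc m)"
          unfolding Q_def u_def by (simp only: idx_multiple[OF h(1)])
        ultimately have "psi u + Q n u \<in> frontier (D u)"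
          using sch[of n] m(3) unfolding scheme_def by metis
        then show ?thesis
          using \<open>s \<le> u\<close> \<open>u \<le> t\<close> by auto
      qed
      have "\<exists>u. \<forall>n. u n \<in> {s..t} \<and> psi (u n) + Q (r (n + N)) (u n) \<in> frontier (D (u n))"
        using contact N by (intro choice allI) (meson le_add2)
      then obtain u where u: "\<And>n. u n \<in> {s..t}"
        "\<And>n. psi (u n) + Q (r (n + N)) (u n) \<in> frontier (D (u n))"
        by blast
      \<comment> \<open>The contact times accumulate at some \<open>w\<close>; continuous
        convergence and closedness of the frontier graph make \<open>w\<close> a contact time of the
        limit.\<close>
      obtain w k where w: "w \<in> {s..t}" and k: "strict_mono k" and uw: "(u \<circ> k) \<longlonglongrightarrow> w"
        using compact_Icc[of s t] u(1) unfolding compact_def by blast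
      have uT: "u (k n) \<in> {0..T}" and wT: "w \<in> {0..T}" for n
        using u(1)[of "k n"] w st by auto
      have uw': "(\<lambda>n. u (k n)) \<longlonglongrightarrow> w"
        using uw by (simp add: o_def)
      have "(\<lambda>n. Q (r (k n + N)) (u (k n))) \<longlonglongrightarrow> lam w"
        using limQ[where k = "\<lambda>n. k n + N", OF _ uT wT uw'] k by (simp add: strict_mono_def)
      moreover have "(\<lambda>n. psi (u (k n))) \<longlonglongrightarrow> psi w"
        by (rule continuous_on_tendsto_compose[OF cont_psi uw']) (use uT wT in auto)
      ultimately have "(\<lambda>n. (u (k n), psi (u (k n)) + Q (r (k n + N)) (u (k n)))) \<longlonglongrightarrow> (w, phi w)"
        unfolding phi_def by (intro tendsto_Pair tendsto_add uw')
      then have "(w, phi w) \<in> {(t, x). t \<in> {0..T} \<and> x \<in> frontier (D t)}"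
        by (rule closed_sequentially[OF closed_frontier_graph, rotated]) (use u uT in auto)
      then show ?thesis
        using w by (auto simp: D_eq)
    qed
  qed (use T_pos cont_phi cont_lam cont_W norm_gamma in \<open>auto simp: phi_def\<close>)
  then show ?thesis
    by blast
qed

end

section \<open>Verification of the abstract setting\<close>

lemma H1_on_imp_continuous:
  assumes "H1_on T f"
  shows "continuous_on {0..T} f"
proof -
  obtain g where g: "\<And>t. t \<in> {0..T} \<Longrightarrow> (g has_integral (f t - f 0)) {0..t}"
    using assms unfolding H1_on_def by blast
  show ?thesis
  proof (cases "0 \<le> T")
    case True
    then have "g integrable_on {0..T}"
      using g[of T] by (auto simp: integrable_on_def)
    then have "continuous_on {0..T} (\<lambda>t. f 0 + integral {0..t} g)"
      by (intro continuous_intros indefinite_integral_continuous_1)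
    then show ?thesis
      by (rule continuous_on_eq) (use integral_unique[OF g] in simp)
  qed simp
qed

theorem theorem4p5:
  fixes T :: real and rho :: real
    and Om' :: "(real \<times> (real ^ 'n)) set"
    and gamma :: "real \<times> (real ^ 'n) \<Rightarrow> real ^ 'n"
    and psi :: "real \<Rightarrow> real ^ 'n"
  defines "Om \<equiv> Om' \<inter> ({0..T} \<times> UNIV)"
  assumes "T > 0"
    and "bounded Om'" and "open Om'" and "connected Om'"
    and "\<forall>t\<in>{0..T}. tsection Om t \<noteq> {} \<and> bounded (tsection Om t) \<and> connected (tsection Om t)"
    and "C12_on T gamma"
    and "\<forall>t\<in>{0..T}. \<forall>x. gamma (t, x) \<in> sphere 0 1"
    and "0 < rho" and "rho < 1"
    and "\<forall>t\<in>{0..T}. \<forall>x\<in>frontier (tsection Om t).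
           (\<Union>\<zeta>\<in>{0..rho}. ball (x - \<zeta> *\<^sub>R gamma (t, x)) (\<zeta> * rho)) \<subseteq> - tsection Om t"
    and "\<forall>x. H1_on T (\<lambda>t. infdist x (tsection Om t))"
    and "continuous_on {0..T} psi"
    and "psi 0 \<in> closure (tsection Om 0)"
  shows "\<exists>phi lam. skorohod_solution T Om gamma psi phi lam"
proof -
  \<comment> \<open>\<open>Om\<close> itself need not be open, but for times in
    \<open>{0..T}\<close> its sections are those of the open set \<open>Om'\<close>.\<close>
  have sec: "tsection Om t = {x. (t, x) \<in> Om'}" if "t \<in> {0..T}" for t
    using that by (auto simp: Om_def tsection_def)
  interpret moving_domain T rho "tsection Om" gamma psi
  proof
    have "(\<Union>t\<in>{0..T}. tsection Om t) \<subseteq> snd ` Om'"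
      by (force simp: sec)
    then show "bounded (\<Union>t\<in>{0..T}. tsection Om t)"
      using bounded_snd[OF \<open>bounded Om'\<close>] bounded_subset by blast
    show "open (tsection Om t)" if "t \<in> {0..T}" for t
      unfolding sec[OF that]
      using open_vimage[OF \<open>open Om'\<close>, of "Pair t"] by (simp add: vimage_def continuous_intros)
    have "{(t, x). t \<in> {0..T} \<and> x \<notin> tsection Om t} = ({0..T} \<times> UNIV) \<inter> - Om'"
      by (auto simp: sec)
    then show "closed {(t, x). t \<in> {0..T} \<and> x \<notin> tsection Om t}"
      using \<open>open Om'\<close> by (metis closed_Compl closed_Int closed_Times closed_UNIV closed_atLeastAtMost)
    show "continuous_on {0..T} (\<lambda>t. infdist x (tsection Om t))" for x
      using assms H1_on_imp_continuous by blast
    show "continuous_on ({0..T} \<times> UNIV) gamma"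
      using \<open>C12_on T gamma\<close> by (auto simp: C12_on_def)
    fix t x z y
    assume t: "t \<in> {0..T}" and x: "x \<in> frontier (tsection Om t)" and z: "0 < z" "z \<le> rho"
      and y: "y \<in> tsection Om t"
    have "z \<in> {0..rho}"
      using z by simp
    then have "ball (x - z *\<^sub>R gamma (t, x)) (z * rho) \<subseteq> - tsection Om t"
      using assms(11) t x by blast
    then show "z * rho \<le> dist (x - z *\<^sub>R gamma (t, x)) y"
      using y by (auto simp: not_less[symmetric] subset_iff)
  qed (use assms in auto)
  show ?thesis
    by (rule ex_skorohod_solution) simp
qed

end
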